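(* Let $m,k,n\ge 1$, let $A$ be a real $m\times m$ matrix and $B$ a real $m\times k$ matrix with $\operatorname{rank}[B, AB, \dots, A^{m-1}B]=m$. Let $g:\mathbb{R}^k\times\mathbb{R}^m\times\mathbb{R}^n\to\mathbb{R}^n$ be Borel measurable and bounded, $\sup_{(u,y,z)}\|g(u,y,z)\|=M_g<\infty$, and Lipschitz continuous in $(y,z)$ uniformly with respect to $u\in\mathbb{R}^k$. Fix $y_0\in\mathbb{R}^m$, $z_0\in\mathbb{R}^n$ and $T>0$. For $\varepsilon>0$ consider the system $$\varepsilon\,\frac{dy(t)}{dt}=Ay(t)+Bu(t),\quad y(0)=y_0,\qquad \frac{dz(t)}{dt}=g(u(t),y(t),z(t)),\quad z(0)=z_0,$$ on $[0,T]$, and let $\mathcal{Z}_T(\varepsilon)$ be the set of all $z$-components $z(\cdot)$ of solutions $(u(\cdot),y(\cdot),z(\cdot))$ of this system, where the control $u(\cdot)$ ranges over measurable functions $[0,T]\to\mathbb{R}^k$ for which the system has a solution. For $z\in\mathbb{R}^n$ let $$V(z):=\overline{\mathrm{co}}\,\{g(u,y,z):\ u\in\mathbb{R}^k,\ y\in\mathbb{R}^m\}$$ (closure of the convex hull), and let $\mathcal{Z}_T$ be the set of solutions on $[0,T]$ of the differential inclusion $\frac{dz(t)}{dt}\in V(z(t))$, $z(0)=z_0$. Then for every $\varepsilon>0$, $$\mathrm{cl}(\mathcal{Z}_T(\varepsilon))=\mathcal{Z}_T,$$ where $\mathrm{cl}$ denotes closure with respect to the uniform convergence metric on $[0,T]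$.
   Context: Solutions of the differential inclusion are absolutely continuous functions $z:[0,T]\to\mathbb{R}^n$ with $z(0)=z_0$ and $\dot z(t)\in V(z(t))$ for almost every $t\in[0,T]$. Solutions of the control system are understood in the Carathéodory (absolutely continuous) sense. *)

theory Defs
  imports "HOL-Analysis.Analysis"
begin

text \<open>Absolute continuity of a function on a set S of reals (classical definition
  with finitely many pairwise disjoint subintervals).\<close>
definition abs_cont_on :: "real set \<Rightarrow> (real \<Rightarrow> 'a::real_normed_vector) \<Rightarrow> bool" where
  "abs_cont_on S f \<longleftrightarrow>
     (\<forall>e>0. \<exists>d>0. \<forall>(N::nat) (a::nat \<Rightarrow> real) b.
        (\<forall>i<N. a i \<le> b i \<and> {a i..b i} \<subseteq> S) \<and>
        (\<forall>i<N. \<forall>j<N. i \<noteq> j \<longrightarrow> {a i<..<b i} \<inter> {a j<..<b j} = {}) \<and>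
        (\<Sum>i<N. b i - a i) < d
        \<longrightarrow> (\<Sum>i<N. norm (f (b i) - f (a i))) < e)"

text \<open>Matrix powers.\<close>
definition matpow :: "real^'m^'m \<Rightarrow> nat \<Rightarrow> real^'m^'m" where
  "matpow A i = (((**) A) ^^ i) (mat 1)"

text \<open>A fixed enumeration of the index type 'm by 0..m-1 (used to order the blocks).\<close>
definition idx_enum :: "'m::finite \<Rightarrow> nat" where
  "idx_enum = (SOME f. bij_betw f (UNIV::'m set) {..<CARD('m)})"

text \<open>Kalman controllability matrix [B, AB, ..., A^(m-1) B], an m x (m k) matrix
  whose columns are indexed by pairs (j, i): column j of block A^i B.\<close>
definition kalman_matrix :: "real^'m^'m \<Rightarrow> real^'k^'m \<Rightarrow> real^('k \<times> 'm)^'m" where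
  "kalman_matrix A B = (\<chi> r. \<chi> p. (matpow A (idx_enum (snd p)) ** B) $ r $ fst p)"

text \<open>z-components of Caratheodory solutions of the singularly perturbed control system.\<close>
definition ctrl_traj ::
  "real^'m^'m \<Rightarrow> real^'k^'m \<Rightarrow> (real^'k \<Rightarrow> real^'m \<Rightarrow> real^'n \<Rightarrow> real^'n)
   \<Rightarrow> real^'m \<Rightarrow> real^'n \<Rightarrow> real \<Rightarrow> real \<Rightarrow> (real \<Rightarrow> real^'n) set" where
  "ctrl_traj A B g y0 z0 T \<epsilon> = {z. \<exists>u y.
      u \<in> borel_measurable (lebesgue_on {0..T}) \<and>
      abs_cont_on {0..T} y \<and> abs_cont_on {0..T} z \<and> y 0 = y0 \<and> z 0 = z0 \<and>
      (AE t in lborel. t \<in> {0..T} \<longrightarrow>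
         (y has_vector_derivative (1/\<epsilon>) *\<^sub>R (A *v y t + B *v u t)) (at t within {0..T}) \<and>
         (z has_vector_derivative g (u t) (y t) (z t)) (at t within {0..T}))}"

text \<open>The right-hand side of the limit differential inclusion.\<close>
definition Vset :: "(real^'k \<Rightarrow> real^'m \<Rightarrow> real^'n \<Rightarrow> real^'n) \<Rightarrow> real^'n \<Rightarrow> (real^'n) set" where
  "Vset g z = closure (convex hull {g u y z | u y. True})"

text \<open>Solutions on [0,T] of the differential inclusion z' \<in> V(z), z(0) = z0.\<close>
definition incl_traj ::
  "(real^'k \<Rightarrow> real^'m \<Rightarrow> real^'n \<Rightarrow> real^'n) \<Rightarrow> real^'n \<Rightarrow> real \<Rightarrow> (real \<Rightarrow> real^'n) set" where
  "incl_traj g z0 T = {z. abs_cont_on {0..T} z \<and> z 0 = z0 \<and>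
      (AE t in lborel. t \<in> {0..T} \<longrightarrow>
         (\<exists>v. (z has_vector_derivative v) (at t within {0..T}) \<and> v \<in> Vset g (z t)))}"

text \<open>z belongs to the closure of S with respect to the uniform metric on [0,T].\<close>
definition in_uclosure :: "real \<Rightarrow> (real \<Rightarrow> 'a::metric_space) set \<Rightarrow> (real \<Rightarrow> 'a) \<Rightarrow> bool" where
  "in_uclosure T S z \<longleftrightarrow> (\<forall>e>0. \<exists>w\<in>S. \<forall>t\<in>{0..T}. dist (z t) (w t) < e)"

end

theory Submission
  imports Defs
begin

text \<open>Both inclusions rest on a mean value property of absolutely continuous functions: if the
  derivative lies almost everywhere in a closed convex set, then so does every difference quotient.

  A uniform limit \<open>z\<close> of trajectories is Lipschitz, hence differentiable almost everywhere. By the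
  mean value property the difference quotients at \<open>t\<close> of the approximating trajectories lie in small
  neighbourhoods of \<open>V (z t)\<close>, and therefore so does the derivative of \<open>z\<close>.

  Conversely, since the controls are unbounded, the Kalman condition allows the fast variable to be
  steered between any two points in arbitrarily short time; as \<open>g\<close> is bounded, these transfers are
  invisible to the slow variable. After a transfer to \<open>\<eta>\<close> the control is held at \<open>v\<close>, and for a short
  time the slow velocity is close to \<open>g v \<eta> \<zeta>\<close>. Repeating and interleaving such phases realizes on
  average every element of the closed convex hull, and Gronwall's inequality compares the resulting
  trajectory with the given solution of the inclusion. All controls used are piecewise constant:
  since \<open>g\<close> is only Borel in the control, this keeps the right-hand side continuous in time off a
  finite set, so that classical Picard iteration applies.\<close>

section \<open>Almost everywhere differentiability of Lipschitz functions\<close>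

text \<open>No limit in \<epsilon> is taken. The factor 1/\<epsilon> is absorbed into the linear
  part, where it affects neither the Kalman condition nor the bounds on \<open>g\<close>, so one
  \<epsilon>-free argument covers every \<epsilon> > 0. Derivatives do not survive uniform
  convergence, but difference quotients over a fixed interval do. This is why trajectories are
  handled through quotients, and why closed convex sets appear: Riemann sums of derivatives stay in
  them. In the converse direction the fast state at the end of a phase is not prescribed, so
  realizability is claimed for every initial fast state. The slow state is frozen while averages are
  produced and updated only on a grid of step h: a cell costs an error of order h^2, the T/h cells
  together an error of order h, and Gronwall multiplies it by a constant independent of h.
  Differentiability of Lipschitz functions comes from Vitali coverings: Lebesgue measure is compared
  with the Stieltjes measure of f(x) + M x on the set where arbitrarily short intervals have slopes
  below p and others have slopes above q, with p < q.\<close>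

lemma Vitali_covering_intervals:
  fixes K :: "(real \<times> real) set"
  assumes K: "\<And>u v. (u, v) \<in> K \<Longrightarrow> u < v"
    and S: "\<And>x d. x \<in> S \<Longrightarrow> 0 < d \<Longrightarrow> \<exists>u v. (u, v) \<in> K \<and> x \<in> {u..v} \<and> v - u < d"
  obtains C where "countable C" "C \<subseteq> K" "disjoint_family_on (\<lambda>i. {fst i..snd i}) C"
    "negligible (S - (\<Union>i\<in>C. {fst i..snd i}))"
proof -
  note result = that
  \<comment> \<open>On the line a closed interval is the closed ball about its midpoint, so the
    covering theorem for balls applies.\<close>
  have cb: "cball ((fst i + snd i) / 2) ((snd i - fst i) / 2) = {fst i..snd i}" for i :: "real \<times> real"
    by (auto simp: cball_eq_atLeastAtMost field_simps)
  show ?thesis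
  proof (rule Vitali_covering_theorem_cballs
      [of K "\<lambda>i. (snd i - fst i) / 2" S "\<lambda>i. (fst i + snd i) / 2"])
    show "0 < (snd i - fst i) / 2" if "i \<in> K" for i
      using that K[of "fst i" "snd i"] by simp
    show "\<exists>i. i \<in> K \<and> x \<in> cball ((fst i + snd i) / 2) ((snd i - fst i) / 2) \<and> (snd i - fst i) / 2 < d"
      if xd: "x \<in> S" "0 < d" for x d
    proof -
      obtain u v where "(u, v) \<in> K" "x \<in> {u..v}" "v - u < d"
        using S[OF xd] by blast
      then show ?thesis
        using xd K[of u v] by (intro exI[of _ "(u, v)"]) (auto simp only: cb, auto)
    qed
  next
    fix C assume C: "countable C" "C \<subseteq> K"
      "pairwise (\<lambda>i j. disjnt (cball ((fst i + snd i) / 2) ((snd i - fst i) / 2))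
         (cball ((fst j + snd j) / 2) ((snd j - fst j) / 2))) C"
      "negligible (S - (\<Union>i\<in>C. cball ((fst i + snd i) / 2) ((snd i - fst i) / 2)))"
    show thesis
    proof (rule result[OF C(1,2)])
      show "disjoint_family_on (\<lambda>i. {fst i..snd i}) C"
        using C(3) unfolding cb disjoint_family_on_def pairwise_def disjnt_def by blast
      show "negligible (S - (\<Union>i\<in>C. {fst i..snd i}))"
        using C(4) unfolding cb .
    qed
  qed
qed

text \<open>Countable additivity turns both sides into integrals over \<open>count_space C\<close>,
  which compare term by term. This carries a slope bound on each interval of a Vitali family over to
  the Stieltjes and Lebesgue measures of the union.\<close>

lemma emeasure_UN_mono_mult:
  assumes "countable C" "disjoint_family_on I C"
    "\<And>i. i \<in> C \<Longrightarrow> I i \<in> sets M" "\<And>i. i \<in> C \<Longrightarrow> I i \<in> sets N"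
    "\<And>i. i \<in> C \<Longrightarrow> emeasure M (I i) \<le> c * emeasure N (I i)"
  shows "emeasure M (\<Union>i\<in>C. I i) \<le> c * emeasure N (\<Union>i\<in>C. I i)"
proof -
  have "emeasure M (\<Union>i\<in>C. I i) = (\<integral>\<^sup>+i. emeasure M (I i) \<partial>count_space C)"
    using assms by (intro emeasure_UN_countable) auto
  also have "\<dots> \<le> (\<integral>\<^sup>+i. c * emeasure N (I i) \<partial>count_space C)"
    using assms by (intro nn_integral_mono) auto
  also have "\<dots> = c * (\<integral>\<^sup>+i. emeasure N (I i) \<partial>count_space C)"
    by (intro nn_integral_cmult) auto
  also have "(\<integral>\<^sup>+i. emeasure N (I i) \<partial>count_space C) = emeasure N (\<Union>i\<in>C. I i)"
    using assms by (intro emeasure_UN_countable[symmetric]) auto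
  finally show ?thesis .
qed

text \<open>The intervals are open so that both sets are \<open>G\<^sub>\<delta>\<close>, hence Borel.\<close>

definition lower_slope_set :: "(real \<Rightarrow> real) \<Rightarrow> real \<Rightarrow> real set" where
  "lower_slope_set f p =
     {x. \<forall>d>0. \<exists>u v. u < x \<and> x < v \<and> v - u < d \<and> f v - f u < p * (v - u)}"

definition upper_slope_set :: "(real \<Rightarrow> real) \<Rightarrow> real \<Rightarrow> real set" where
  "upper_slope_set f q =
     {x. \<forall>d>0. \<exists>u v. u < x \<and> x < v \<and> v - u < d \<and> f v - f u > q * (v - u)}"

lemma borel_small_intervals:
  "{x::real. \<forall>d>0. \<exists>u v. u < x \<and> x < v \<and> v - u < d \<and> P u v} \<in> sets borel"
proof -
  have "{x. \<forall>d>0. \<exists>u v. u < x \<and> x < v \<and> v - u < d \<and> P u v} =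
    (\<Inter>n. \<Union>(u,v)\<in>{(u,v). v - u < inverse (real (Suc n)) \<and> P u v}. {u<..<v})" (is "?L = ?R")
  proof
    show "?L \<subseteq> ?R"
    proof
      fix x assume x: "x \<in> ?L"
      show "x \<in> ?R"
      proof
        fix n
        have "inverse (real (Suc n)) > 0" by simp
        with x obtain u v where "u < x" "x < v" "v - u < inverse (real (Suc n))" "P u v"
          by blast
        then show "x \<in> (\<Union>(u,v)\<in>{(u,v). v - u < inverse (real (Suc n)) \<and> P u v}. {u<..<v})"
          by force
      qed
    qed
    show "?R \<subseteq> ?L"
    proof (intro subsetI CollectI allI impI)
      fix x and d :: real assume x: "x \<in> ?R" and "d > 0"
      obtain n where n: "inverse (real (Suc n)) < d"
        using reals_Archimedean[OF \<open>d > 0\<close>] by blast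
      have "x \<in> (\<Union>(u,v)\<in>{(u,v). v - u < inverse (real (Suc n)) \<and> P u v}. {u<..<v})"
        using x by blast
      then show "\<exists>u v. u < x \<and> x < v \<and> v - u < d \<and> P u v"
        using n by fastforce
    qed
  qed
  moreover have "?R \<in> sets borel"
    by (intro sets.countable_INT'' borel_open open_UN) auto
  ultimately show ?thesis by simp
qed

text \<open>Let s be the Lebesgue measure of the set, finite because of the restriction to (-R, R),
  and \<nu> the Stieltjes measure of \<open>f\<close>. Disjoint intervals of slope below p inside an
  open set of measure at most s + e give a set \<open>W\<close> with \<nu>(W) at most p (s + e).
  Disjoint intervals of slope above q inside \<open>W\<close> still cover almost everything, so q s
  is at most \<nu>(W). Letting e tend to 0 leaves q s \<le> p s, which forces s = 0.\<close>

lemma null_slope_gap_mono: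
  fixes f :: "real \<Rightarrow> real"
  assumes mono: "mono f" and cont: "continuous_on UNIV f" and pq: "p < q"
  shows "negligible (lower_slope_set f p \<inter> upper_slope_set f q \<inter> {-R<..<R})"
proof (cases "p > 0")
  case False
  have "lower_slope_set f p = {}"
  proof (rule ccontr)
    assume "lower_slope_set f p \<noteq> {}"
    then obtain x where "x \<in> lower_slope_set f p" by blast
    moreover have "(1::real) > 0" by simp
    ultimately obtain u v where "u < x" "x < v" "f v - f u < p * (v - u)"
      unfolding lower_slope_set_def by blast
    moreover have "f u \<le> f v" using mono \<open>u < x\<close> \<open>x < v\<close> by (simp add: monoD)
    moreover have "p * (v - u) \<le> 0"
      using False \<open>u < x\<close> \<open>x < v\<close> by (intro mult_nonpos_nonneg) auto
    ultimately show False by simp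
  qed
  then show ?thesis by simp
next
  case True
  define E where "E = lower_slope_set f p \<inter> upper_slope_set f q \<inter> {-R<..<R}"
  have E[measurable]: "E \<in> sets borel"
    unfolding E_def lower_slope_set_def upper_slope_set_def
    by (intro sets.Int borel_small_intervals) auto
  let ?\<nu> = "interval_measure f"
  have sets_\<nu>[simp, measurable_cong]: "sets ?\<nu> = sets borel" by simp
  have \<nu>: "emeasure ?\<nu> {u..v} = ennreal (f v - f u)" if "u \<le> v" for u v
    by (rule emeasure_interval_measure_Icc[OF that monoD[OF mono] cont])
  have "emeasure lborel E \<le> emeasure lborel {-R<..<R}"
    by (intro emeasure_mono) (auto simp: E_def)
  also have "\<dots> < \<infinity>" by (simp add: emeasure_lborel_box_eq flip: box_real)
  finally have fin: "emeasure lborel E < \<infinity>" .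
  define s where "s = measure lborel E"
  have s: "emeasure lborel E = ennreal s"
    using fin by (simp add: s_def emeasure_eq_ennreal_measure)
  have s0: "s \<ge> 0" by (simp add: s_def)
  have "q * s \<le> p * (s + e)" if e: "e > 0" for e
  proof -
    obtain U where U: "open U" "E \<subseteq> U" "emeasure lborel (U - E) < ennreal e"
      using outer_regular_lborel[OF E e] by blast
    have [measurable]: "U \<in> sets borel" using U by simp
    have "emeasure lborel U = emeasure lborel E + emeasure lborel (U - E)"
      using U by (subst plus_emeasure) (auto intro!: arg_cong[where f="emeasure lborel"])
    also have "\<dots> \<le> ennreal s + ennreal e" using U s by (intro add_mono) auto
    finally have \<mu>U: "emeasure lborel U \<le> ennreal (s + e)" using s0 e by simp
    define K1 where "K1 = {(u, v). u < v \<and> {u..v} \<subseteq> U \<and> f v - f u < p * (v - u)}"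
    have "\<exists>u v. (u, v) \<in> K1 \<and> x \<in> {u..v} \<and> v - u < d" if "x \<in> E" "d > 0" for x d
    proof -
      obtain r where r: "r > 0" "ball x r \<subseteq> U" using U \<open>x \<in> E\<close> open_contains_ball by blast
      have "min r d > 0" using r that by simp
      then obtain u v where uv: "u < x" "x < v" "v - u < min r d" "f v - f u < p * (v - u)"
        using \<open>x \<in> E\<close> unfolding E_def lower_slope_set_def by blast
      have "{u..v} \<subseteq> ball x r" using uv by (auto simp: dist_real_def)
      with uv r show ?thesis unfolding K1_def by (intro exI[of _ u] exI[of _ v]) auto
    qed
    then obtain C1 where C1: "countable C1" "C1 \<subseteq> K1"
      "disjoint_family_on (\<lambda>i. {fst i..snd i}) C1" "negligible (E - (\<Union>i\<in>C1. {fst i..snd i}))"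
      by (rule Vitali_covering_intervals[of K1 E, rotated]) (auto simp: K1_def)
    \<comment> \<open>Open intervals are taken so that the second Vitali family fits inside
      \<open>W\<close>; only countably many end points are lost.\<close>
    define W where "W = (\<Union>i\<in>C1. {fst i<..<snd i})"
    have "open W" unfolding W_def by auto
    then have [measurable]: "W \<in> sets borel" by simp
    have "E - W \<subseteq> (E - (\<Union>i\<in>C1. {fst i..snd i})) \<union> (fst ` C1 \<union> snd ` C1)"
      unfolding W_def by (auto simp: image_iff) (metis fst_conv snd_conv order_less_le)
    moreover have "negligible (fst ` C1 \<union> snd ` C1)"
      using C1 by (auto simp: negligible_iff_null_sets intro!: null_sets_completionI countable_imp_null_set_lborel)
    ultimately have negEW: "negligible (E - W)"
      using C1(4) by (meson negligible_Un negligible_subset)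
    have UC1[measurable]: "(\<Union>i\<in>C1. {fst i..snd i}) \<in> sets borel"
      using C1 by (intro sets.countable_UN') auto
    have "emeasure ?\<nu> W \<le> emeasure ?\<nu> (\<Union>i\<in>C1. {fst i..snd i})"
      by (intro emeasure_mono) (auto simp: W_def intro!: UC1)
    also have "\<dots> \<le> ennreal p * emeasure lborel (\<Union>i\<in>C1. {fst i..snd i})"
    proof (rule emeasure_UN_mono_mult[OF C1(1,3)])
      fix i assume "i \<in> C1"
      then have "fst i < snd i" "f (snd i) - f (fst i) < p * (snd i - fst i)"
        using C1(2) by (auto simp: K1_def)
      then show "emeasure ?\<nu> {fst i..snd i} \<le> ennreal p * emeasure lborel {fst i..snd i}"
        using True by (simp add: \<nu> flip: ennreal_mult)
    qed auto
    also have "\<dots> \<le> ennreal p * emeasure lborel U"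
      using C1(2) by (intro mult_left_mono emeasure_mono UN_least) (force simp: K1_def)+
    also have "\<dots> \<le> ennreal p * ennreal (s + e)" using \<mu>U by (intro mult_left_mono) auto
    finally have up: "emeasure ?\<nu> W \<le> ennreal (p * (s + e))"
      using True s0 e by (subst ennreal_mult) auto
    define K2 where "K2 = {(u, v). u < v \<and> {u..v} \<subseteq> W \<and> f v - f u > q * (v - u)}"
    have "\<exists>u v. (u, v) \<in> K2 \<and> x \<in> {u..v} \<and> v - u < d" if "x \<in> E \<inter> W" "d > 0" for x d
    proof -
      obtain r where r: "r > 0" "ball x r \<subseteq> W" using \<open>open W\<close> \<open>x \<in> E \<inter> W\<close> open_contains_ball by blast
      have "min r d > 0" using r that by simp
      then obtain u v where uv: "u < x" "x < v" "v - u < min r d" "f v - f u > q * (v - u)"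
        using \<open>x \<in> E \<inter> W\<close> unfolding E_def upper_slope_set_def by blast
      have "{u..v} \<subseteq> ball x r" using uv by (auto simp: dist_real_def)
      with uv r show ?thesis unfolding K2_def by (intro exI[of _ u] exI[of _ v]) auto
    qed
    then obtain C2 where C2: "countable C2" "C2 \<subseteq> K2"
      "disjoint_family_on (\<lambda>i. {fst i..snd i}) C2"
      "negligible (E \<inter> W - (\<Union>i\<in>C2. {fst i..snd i}))"
      by (rule Vitali_covering_intervals[of K2 "E \<inter> W", rotated]) (auto simp: K2_def)
    have UC2[measurable]: "(\<Union>i\<in>C2. {fst i..snd i}) \<in> sets borel"
      using C2 by (intro sets.countable_UN') auto
    have "negligible (E - (\<Union>i\<in>C2. {fst i..snd i}))"
      by (rule negligible_subset[OF negligible_Un[OF negEW C2(4)]]) auto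
    then have null: "E - (\<Union>i\<in>C2. {fst i..snd i}) \<in> null_sets lborel"
      by (auto simp: negligible_iff_null_sets null_sets_completion_iff)
    have "emeasure lborel E \<le> emeasure lborel ((\<Union>i\<in>C2. {fst i..snd i}) \<union> (E - (\<Union>i\<in>C2. {fst i..snd i})))"
      by (intro emeasure_mono) auto
    also have "\<dots> = emeasure lborel (\<Union>i\<in>C2. {fst i..snd i})"
      by (rule emeasure_Un_null_set[OF _ null]) auto
    also have "\<dots> \<le> ennreal (1 / q) * emeasure ?\<nu> (\<Union>i\<in>C2. {fst i..snd i})"
    proof (rule emeasure_UN_mono_mult[OF C2(1,3)])
      fix i assume "i \<in> C2"
      then have i: "fst i < snd i" "q * (snd i - fst i) < f (snd i) - f (fst i)"
        using C2(2) by (auto simp: K2_def)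
      have "f (fst i) \<le> f (snd i)" using i mono by (simp add: monoD)
      then show "emeasure lborel {fst i..snd i} \<le> ennreal (1/q) * emeasure ?\<nu> {fst i..snd i}"
        using True pq i by (simp add: \<nu> field_simps flip: ennreal_mult)
    qed auto
    also have "\<dots> \<le> ennreal (1 / q) * emeasure ?\<nu> W"
      using C2(2) by (intro mult_left_mono emeasure_mono UN_least) (force simp: K2_def)+
    also have "\<dots> \<le> ennreal (1 / q) * ennreal (p * (s + e))"
      using up by (intro mult_left_mono) auto
    also have "\<dots> = ennreal (p * (s + e) / q)"
      using True pq s0 e by (subst ennreal_mult[symmetric]) auto
    finally have "s \<le> p * (s + e) / q"
      using True pq s0 e by (simp add: s)
    then show ?thesis using True pq by (simp add: field_simps)
  qed
  note gap = this
  have "q * s \<le> p * s"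
  proof (rule field_le_epsilon)
    fix e :: real assume "e > 0"
    then show "q * s \<le> p * s + e"
      using gap[of "e / p"] True by (simp add: distrib_left)
  qed
  then have "s = 0" using pq s0 by (smt (verit) mult_strict_right_mono)
  then have "E \<in> null_sets lborel" using s by (auto intro: null_setsI)
  then show ?thesis unfolding E_def[symmetric] negligible_iff_null_sets by (auto intro: null_sets_completionI)
qed

text \<open>Adding M x makes the function nondecreasing and raises every slope by M, so the gap
  between p and q merely moves to the one between p + M and q + M. The bounded pieces (-n, n)
  exhaust the line.\<close>

lemma null_slope_gap_lipschitz:
  fixes f :: "real \<Rightarrow> real"
  assumes lip: "M-lipschitz_on UNIV f" and pq: "p < q"
  shows "negligible (lower_slope_set f p \<inter> upper_slope_set f q)"
proof -
  define h where "h x = f x + M * x" for x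
  have lo: "lower_slope_set h (p + M) = lower_slope_set f p"
    unfolding lower_slope_set_def h_def by (simp add: algebra_simps)
  have hi: "upper_slope_set h (q + M) = upper_slope_set f q"
    unfolding upper_slope_set_def h_def by (simp add: algebra_simps)
  have mono: "mono h"
  proof (rule monoI)
    fix x y :: real assume "x \<le> y"
    then show "h x \<le> h y"
      using lipschitz_onD[OF lip, of x y] by (auto simp: h_def dist_real_def algebra_simps)
  qed
  have "continuous_on UNIV h"
    unfolding h_def by (intro continuous_intros lipschitz_on_continuous_on[OF lip])
  then have "negligible (\<Union>n::nat. lower_slope_set f p \<inter> upper_slope_set f q \<inter> {- real n<..<real n})"
    using null_slope_gap_mono[OF mono, of "p + M" "q + M"] pq
    by (intro negligible_countable_Union) (auto simp: lo hi)
  moreover have "x \<in> (\<Union>n::nat. {- real n<..<real n})" for x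
    using reals_Archimedean2[of "\<bar>x\<bar>"] by (auto simp: abs_less_iff) (metis minus_less_iff)
  then have "(\<Union>n::nat. lower_slope_set f p \<inter> upper_slope_set f q \<inter> {- real n<..<real n}) =
    lower_slope_set f p \<inter> upper_slope_set f q" by blast
  ultimately show ?thesis by simp
qed

text \<open>The candidate D is the infimum of all p for which arbitrarily short intervals around x
  have slope below p. Short intervals then have slope at least D - e by the definition of D. They
  have slope at most D + e because two rationals p' < q just above D would otherwise put x into an
  excluded gap.\<close>

lemma lipschitz_derivative_outside_slope_gaps:
  fixes f :: "real \<Rightarrow> real"
  assumes lip: "M-lipschitz_on UNIV f"
    and gaps: "\<And>p q. p \<in> \<rat> \<Longrightarrow> q \<in> \<rat> \<Longrightarrow> p < q \<Longrightarrow> x \<notin> lower_slope_set f p \<inter> upper_slope_set f q"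
  shows "\<exists>D. (f has_real_derivative D) (at x)"
proof -
  define Q where "Q = {p. x \<in> lower_slope_set f p}"
  have lipD: "\<bar>f v - f u\<bar> \<le> M * (v - u)" if "u \<le> v" for u v
    using lipschitz_onD[OF lip, of v u] that by (simp add: dist_real_def)
  \<comment> \<open>M + 1 instead of M, since membership demands a strict inequality. With the lower
    bound -M below, the infimum is a real number.\<close>
  have "M + 1 \<in> Q"
    unfolding Q_def lower_slope_set_def
  proof (intro CollectI allI impI)
    fix d :: real assume "d > 0"
    then have "f (x + d/4) - f (x - d/4) < (M + 1) * ((x + d/4) - (x - d/4))"
      using abs_ge_self[of "f (x + d/4) - f (x - d/4)"] lipD[of "x - d/4" "x + d/4"]
      by (simp add: distrib_right del: abs_ge_self)
    with \<open>d > 0\<close> show "\<exists>u v. u < x \<and> x < v \<and> v - u < d \<and> f v - f u < (M + 1) * (v - u)"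
      by (intro exI[of _ "x - d/4"] exI[of _ "x + d/4"]) auto
  qed
  then have ne: "Q \<noteq> {}" by blast
  have "-M \<le> p" if "p \<in> Q" for p
  proof (rule ccontr)
    assume "\<not> -M \<le> p"
    moreover have "(1::real) > 0" by simp
    then obtain u v where uv: "u < x" "x < v" "f v - f u < p * (v - u)"
      using \<open>p \<in> Q\<close> unfolding Q_def lower_slope_set_def by blast
    ultimately have "p * (v - u) \<le> (-M) * (v - u)" by (intro mult_right_mono) auto
    then show False using lipD[of u v] uv by auto
  qed
  then have bdd: "bdd_below Q" by (meson bdd_belowI)
  define D where "D = Inf Q"
  have near: "\<exists>d>0. \<forall>u v. u < x \<and> x < v \<and> v - u < d \<longrightarrow> \<bar>f v - f u - D * (v - u)\<bar> \<le> e * (v - u)"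
    if e: "e > 0" for e
  proof -
    have "D - e \<notin> Q"
      using cInf_lower[OF _ bdd, of "D - e"] e unfolding D_def by auto
    then obtain d1 where d1: "d1 > 0"
      "\<And>u v. \<not> (u < x \<and> x < v \<and> v - u < d1 \<and> f v - f u < (D - e) * (v - u))"
      unfolding Q_def lower_slope_set_def mem_Collect_eq by blast
    obtain p where p: "p \<in> Q" "p < D + e"
      using cInf_lessD[OF ne, of "D + e"] e unfolding D_def by auto
    obtain p' where p': "p' \<in> \<rat>" "p < p'" "p' < D + e" using Rats_dense_in_real[OF p(2)] by blast
    obtain q where q: "q \<in> \<rat>" "p' < q" "q < D + e" using Rats_dense_in_real[OF p'(3)] by blast
    have "x \<in> lower_slope_set f p'"
      unfolding lower_slope_set_def
    proof (intro CollectI allI impI)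
      fix d :: real assume "d > 0"
      then obtain u v where uv: "u < x" "x < v" "v - u < d" "f v - f u < p * (v - u)"
        using p(1) unfolding Q_def lower_slope_set_def by blast
      have "p * (v - u) \<le> p' * (v - u)" using p' uv by (intro mult_right_mono) auto
      with uv(4) have "f v - f u < p' * (v - u)" by (rule less_le_trans)
      with uv show "\<exists>u v. u < x \<and> x < v \<and> v - u < d \<and> f v - f u < p' * (v - u)"
        by blast
    qed
    then have "x \<notin> upper_slope_set f q" using gaps[OF p'(1) q(1,2)] by blast
    then obtain d2 where d2: "d2 > 0"
      "\<And>u v. \<not> (u < x \<and> x < v \<and> v - u < d2 \<and> q * (v - u) < f v - f u)"
      unfolding upper_slope_set_def mem_Collect_eq by blast
    show ?thesis
    proof (intro exI[of _ "min d1 d2"] conjI allI impI)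
      show "min d1 d2 > 0" using d1 d2 by simp
      fix u v assume uv: "u < x \<and> x < v \<and> v - u < min d1 d2"
      have "q * (v - u) \<le> (D + e) * (v - u)" using q uv by (intro mult_right_mono) auto
      then show "\<bar>f v - f u - D * (v - u)\<bar> \<le> e * (v - u)"
        using d1(2)[of u v] d2(2)[of u v] uv by (auto simp: algebra_simps abs_le_iff)
    qed
  qed
  have cont: "continuous_on UNIV f" by (rule lipschitz_on_continuous_on[OF lip])
  then have tends: "(f \<longlongrightarrow> f x) (at x within S)" for S
    by (metis UNIV_I continuous_on_def tendsto_within_subset top_greatest)
  have "(f has_derivative (\<lambda>h. h * D)) (at x)"
    unfolding has_derivative_at_alt
  proof (intro conjI allI impI)
    show "bounded_linear (\<lambda>h. h * D)" by (rule bounded_linear_mult_left)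
    fix e :: real assume "e > 0"
    obtain d where d: "d > 0"
      "\<And>u v. u < x \<Longrightarrow> x < v \<Longrightarrow> v - u < d \<Longrightarrow> \<bar>f v - f u - D * (v - u)\<bar> \<le> e * (v - u)"
      using near[OF \<open>e > 0\<close>] by blast
    show "\<exists>d>0. \<forall>y. norm (y - x) < d \<longrightarrow> norm (f y - f x - (y - x) * D) \<le> e * norm (y - x)"
    proof (intro exI[of _ d] conjI allI impI)
      fix y assume y: "norm (y - x) < d"
      consider "y = x" | "y > x" | "y < x" by linarith
      then show "norm (f y - f x - (y - x) * D) \<le> e * norm (y - x)"
      proof cases
        \<comment> \<open>The estimate is known only for intervals with x in their interior, so the
          other end point is moved to x using continuity of \<open>f\<close>.\<close>
        case 2
        have "((\<lambda>u. e * (y - u) - \<bar>f y - f u - D * (y - u)\<bar>) \<longlongrightarrow>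
            e * (y - x) - \<bar>f y - f x - D * (y - x)\<bar>) (at_left x)"
          by (intro tendsto_intros tends)
        moreover have "\<forall>\<^sub>F u in at_left x. 0 \<le> e * (y - u) - \<bar>f y - f u - D * (y - u)\<bar>"
          by (rule eventually_mono[OF eventually_at_left_real[of "y - d" x]])
            (use d(2)[of _ y] 2 y in \<open>auto simp: abs_less_iff\<close>)
        ultimately have "0 \<le> e * (y - x) - \<bar>f y - f x - D * (y - x)\<bar>"
          by (intro tendsto_lowerbound) auto
        then show ?thesis using 2 by (simp add: mult.commute)
      next
        case 3
        have "((\<lambda>v. e * (v - y) - \<bar>f v - f y - D * (v - y)\<bar>) \<longlongrightarrow>
            e * (x - y) - \<bar>f x - f y - D * (x - y)\<bar>) (at_right x)"
          by (intro tendsto_intros tends)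
        moreover have "\<forall>\<^sub>F v in at_right x. 0 \<le> e * (v - y) - \<bar>f v - f y - D * (v - y)\<bar>"
          by (rule eventually_mono[OF eventually_at_right_real[of x "y + d"]])
            (use d(2)[of y] 3 y in \<open>auto simp: abs_less_iff\<close>)
        ultimately have "0 \<le> e * (x - y) - \<bar>f x - f y - D * (x - y)\<bar>"
          by (intro tendsto_lowerbound) auto
        then show ?thesis using 3 by (simp add: mult.commute abs_minus_commute algebra_simps)
      qed simp
    qed (use d in simp)
  qed
  then have "(f has_real_derivative D) (at x)"
    by (simp add: has_field_derivative_def mult_commute_abs)
  then show ?thesis ..
qed

text \<open>Differentiability is checked coordinate by coordinate. Rational pairs p < q are enough
  to exclude every slope gap, so the exceptional set of a coordinate lies in a countable union of
  null sets.\<close>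

lemma lipschitz_AE_vector_derivative:
  fixes f :: "real \<Rightarrow> 'a::euclidean_space"
  assumes lip: "M-lipschitz_on UNIV f"
  shows "AE x in lborel. \<exists>D. (f has_vector_derivative D) (at x)"
proof -
  have comp: "AE x in lborel. \<exists>D. ((\<lambda>x. f x \<bullet> b) has_real_derivative D) (at x)"
    if b: "b \<in> Basis" for b
  proof -
    let ?f = "\<lambda>x. f x \<bullet> b"
    have lipb: "M-lipschitz_on UNIV ?f"
    proof (rule lipschitz_onI)
      fix x y
      have "\<bar>(f x - f y) \<bullet> b\<bar> \<le> norm (f x - f y)" by (rule Basis_le_norm[OF b])
      then show "dist (f x \<bullet> b) (f y \<bullet> b) \<le> M * dist x y"
        using lipschitz_onD[OF lip, of x y] by (simp add: dist_norm inner_diff_left)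
    qed (rule lipschitz_on_nonneg[OF lip])
    let ?N = "\<Union>(p, q)\<in>{(p, q)\<in>\<rat> \<times> \<rat>. p < q}. lower_slope_set ?f p \<inter> upper_slope_set ?f q"
    have "countable ({(p, q)\<in>\<rat> \<times> \<rat>. p < q} :: (real \<times> real) set)"
      by (rule countable_subset[of _ "\<rat> \<times> \<rat>"]) (auto simp: countable_rat)
    then have "negligible ?N"
      by (intro negligible_countable_Union) (auto intro!: null_slope_gap_lipschitz[OF lipb])
    \<comment> \<open>Negligible sets are null for the completed measure, whereas the claim is about
      \<open>lborel\<close>; hence the passage to a Borel null superset.\<close>
    then obtain N where N: "N \<in> null_sets lborel" "?N \<subseteq> N"
      by (auto simp: negligible_iff_null_sets null_sets_completion_iff2)
    show ?thesis
    proof (rule AE_I'[OF N(1)], safe)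
      fix x assume no: "\<not> (\<exists>D. (?f has_real_derivative D) (at x))"
      show "x \<in> N"
      proof (rule ccontr)
        assume "x \<notin> N"
        then have "\<And>p q. p \<in> \<rat> \<Longrightarrow> q \<in> \<rat> \<Longrightarrow> p < q \<Longrightarrow> x \<notin> lower_slope_set ?f p \<inter> upper_slope_set ?f q"
          using N(2) by blast
        from lipschitz_derivative_outside_slope_gaps[OF lipb this] no show False by blast
      qed
    qed
  qed
  have "AE x in lborel. \<forall>b\<in>Basis. \<exists>D. ((\<lambda>x. f x \<bullet> b) has_real_derivative D) (at x)"
    using comp by (intro AE_ball_countable[THEN iffD2]) (auto intro: countable_finite)
  then show ?thesis
  proof (rule AE_mp, intro AE_I2 impI)
    fix x assume "\<forall>b\<in>Basis. \<exists>D. ((\<lambda>x. f x \<bullet> b) has_real_derivative D) (at x)"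
    then obtain D where D: "\<And>b. b \<in> Basis \<Longrightarrow> ((\<lambda>x. f x \<bullet> b) has_real_derivative D b) (at x)"
      by metis
    have "((\<lambda>x. \<Sum>b\<in>Basis. (f x \<bullet> b) *\<^sub>R b) has_vector_derivative (\<Sum>b\<in>Basis. D b *\<^sub>R b)) (at x)"
      using D by (auto intro!: derivative_eq_intros simp: has_real_derivative_iff_has_vector_derivative)
    then show "\<exists>D. (f has_vector_derivative D) (at x)"
      by (auto simp: euclidean_representation)
  qed
qed

section \<open>Absolutely continuous functions\<close>

lemma lipschitz_imp_abs_cont_on:
  fixes f :: "real \<Rightarrow> 'a::real_normed_vector"
  assumes lip: "M-lipschitz_on S f"
  shows "abs_cont_on S f"
  unfolding abs_cont_on_def
proof (intro allI impI)
  fix e :: real assume "e > 0"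
  have M: "M \<ge> 0" by (rule lipschitz_on_nonneg[OF lip])
  show "\<exists>d>0. \<forall>(N::nat) a b. (\<forall>i<N. a i \<le> b i \<and> {a i..b i} \<subseteq> S) \<and>
        (\<forall>i<N. \<forall>j<N. i \<noteq> j \<longrightarrow> {a i<..<b i} \<inter> {a j<..<b j} = {}) \<and>
        (\<Sum>i<N. b i - a i) < d \<longrightarrow> (\<Sum>i<N. norm (f (b i) - f (a i))) < e"
  \<comment> \<open>The summand 1 keeps the quotient meaningful when M = 0.\<close>
  proof (intro exI[of _ "e / (M + 1)"] conjI allI impI)
    show "e / (M + 1) > 0" using M \<open>e > 0\<close> by simp
    fix N :: nat and a b :: "nat \<Rightarrow> real"
    assume *: "(\<forall>i<N. a i \<le> b i \<and> {a i..b i} \<subseteq> S) \<and>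
        (\<forall>i<N. \<forall>j<N. i \<noteq> j \<longrightarrow> {a i<..<b i} \<inter> {a j<..<b j} = {}) \<and>
        (\<Sum>i<N. b i - a i) < e / (M + 1)"
    have "(\<Sum>i<N. norm (f (b i) - f (a i))) \<le> (\<Sum>i<N. (M + 1) * (b i - a i))"
    proof (rule sum_mono)
      fix i assume "i \<in> {..<N}"
      then have i: "a i \<le> b i" "{a i..b i} \<subseteq> S" using * by auto
      then have "norm (f (b i) - f (a i)) \<le> M * (b i - a i)"
        using lipschitz_onD[OF lip, of "b i" "a i"] by (simp add: dist_norm subset_iff)
      then show "norm (f (b i) - f (a i)) \<le> (M + 1) * (b i - a i)"
        using i by (simp add: distrib_right)
    qed
    also have "\<dots> = (M + 1) * (\<Sum>i<N. b i - a i)" by (simp add: sum_distrib_left)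
    also have "\<dots> < e" using * M by (simp add: field_simps)
    finally show "(\<Sum>i<N. norm (f (b i) - f (a i))) < e" .
  qed
qed

text \<open>A tagged division compares \<open>f b - f a\<close> with a Riemann sum of values in \<open>C\<close>: the tags in
  the exceptional null set are forced by the gauge into an open set of small measure, where
  absolute continuity makes their contribution small.\<close>

lemma abs_cont_on_mean_value:
  fixes f :: "real \<Rightarrow> 'a::real_normed_vector"
  assumes ac: "abs_cont_on {l..r} f" and ab: "l \<le> a" "a < b" "b \<le> r"
    and C: "closed C" "convex C" "C \<noteq> {}"
    and deriv: "AE t in lborel. t \<in> {a..b} \<longrightarrow> (\<exists>v\<in>C. (f has_vector_derivative v) (at t within {l..r}))"
  shows "(1 / (b - a)) *\<^sub>R (f b - f a) \<in> C"
proof -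
  obtain N where N: "N \<in> null_sets lborel" and
    exc: "\<And>t. t \<in> {a..b} - N \<Longrightarrow> \<exists>v\<in>C. (f has_vector_derivative v) (at t within {l..r})"
  proof -
    obtain N where "{t \<in> space lborel. \<not> (t \<in> {a..b} \<longrightarrow> (\<exists>v\<in>C. (f has_vector_derivative v) (at t within {l..r})))} \<subseteq> N"
      "emeasure lborel N = 0" "N \<in> sets lborel"
      using deriv by (rule AE_E)
    then show ?thesis by (intro that[of N]) auto
  qed
  obtain c0 where c0: "c0 \<in> C" using C by blast
  \<comment> \<open>The default \<open>c0\<close> lies in \<open>C\<close>, so a Riemann sum of
    \<open>\<phi>\<close> remains in a multiple of \<open>C\<close> even when some tags are
    bad.\<close>
  obtain \<phi> where \<phi>C: "\<And>t. \<phi> t \<in> C" and bad: "\<And>t. t \<in> N \<Longrightarrow> \<phi> t = c0"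
    and \<phi>: "\<And>t. t \<in> {a..b} - N \<Longrightarrow> (f has_vector_derivative \<phi> t) (at t within {l..r})"
  proof -
    obtain h where h: "\<And>t. t \<in> {a..b} - N \<Longrightarrow> h t \<in> C \<and> (f has_vector_derivative h t) (at t within {l..r})"
      using exc by metis
    show ?thesis
      by (rule that[of "\<lambda>t. if t \<in> {a..b} - N then h t else c0"]) (use h c0 in auto)
  qed
  have approx: "\<exists>c\<in>C. norm ((f b - f a) - (b - a) *\<^sub>R c) \<le> e" if e: "e > 0" for e
  proof -
    obtain d where d: "d > 0" "\<And>n (\<alpha>::nat \<Rightarrow> real) \<beta>. (\<forall>i<n. \<alpha> i \<le> \<beta> i \<and> {\<alpha> i..\<beta> i} \<subseteq> {l..r}) \<Longrightarrow>
        (\<forall>i<n. \<forall>j<n. i \<noteq> j \<longrightarrow> {\<alpha> i<..<\<beta> i} \<inter> {\<alpha> j<..<\<beta> j} = {}) \<Longrightarrow>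
        (\<Sum>i<n. \<beta> i - \<alpha> i) < d \<Longrightarrow> (\<Sum>i<n. norm (f (\<beta> i) - f (\<alpha> i))) < e / 3"
    proof -
      have "e / 3 > 0" using e by simp
      then obtain d where "d > 0" and d: "\<forall>(n::nat) (\<alpha>::nat \<Rightarrow> real) \<beta>.
        (\<forall>i<n. \<alpha> i \<le> \<beta> i \<and> {\<alpha> i..\<beta> i} \<subseteq> {l..r}) \<and>
        (\<forall>i<n. \<forall>j<n. i \<noteq> j \<longrightarrow> {\<alpha> i<..<\<beta> i} \<inter> {\<alpha> j<..<\<beta> j} = {}) \<and>
        (\<Sum>i<n. \<beta> i - \<alpha> i) < d \<longrightarrow> (\<Sum>i<n. norm (f (\<beta> i) - f (\<alpha> i))) < e / 3"
        using ac[unfolded abs_cont_on_def, THEN spec, THEN mp] by blast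
      from \<open>d > 0\<close> show ?thesis
        by (rule that[of d]) (rule d[rule_format], simp)
    qed
    \<comment> \<open>Bad tags will carry total length below \<open>d'\<close>; the second bound
      makes the default value \<open>c0\<close> cost at most e/3 on them.\<close>
    define d' where "d' = min d (e / (3 * (norm c0 + 1)))"
    have pos: "norm c0 + 1 > 0" by (simp add: add_nonneg_pos)
    have d': "d' > 0" "d' \<le> d" "norm c0 * d' \<le> e / 3"
    proof -
      show "d' > 0" "d' \<le> d" using d e pos by (auto simp: d'_def)
      have "norm c0 * d' \<le> norm c0 * (e / (3 * (norm c0 + 1)))"
        by (intro mult_left_mono) (auto simp: d'_def)
      also have "\<dots> \<le> (norm c0 + 1) * (e / (3 * (norm c0 + 1)))"
        using e pos by (intro mult_right_mono) auto
      also have "\<dots> = e / 3" using pos by (simp add: field_simps)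
      finally show "norm c0 * d' \<le> e / 3" .
    qed
    obtain U where U: "open U" "N \<subseteq> U" "emeasure lborel (U - N) < ennreal d'"
      using outer_regular_lborel[of N d'] N d' by (metis null_setsD2 sets_lborel)
    have \<mu>U: "emeasure lborel U < ennreal d'"
      using U N by (simp add: emeasure_Diff_null_set)
    define e1 where "e1 = e / (3 * (b - a))"
    have e1: "e1 > 0" using e ab by (simp add: e1_def)
    have "\<exists>\<delta>>0. \<forall>y\<in>{l..r}. \<bar>y - t\<bar> < \<delta> \<longrightarrow> norm (f y - f t - (y - t) *\<^sub>R \<phi> t) \<le> e1 * \<bar>y - t\<bar>"
      if "t \<in> {a..b} - N" for t
      using \<phi>[OF that] e1 unfolding has_vector_derivative_def has_derivative_within_alt
      by auto
    then obtain \<delta> where \<delta>: "\<And>t. t \<in> {a..b} - N \<Longrightarrow> \<delta> t > 0"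
      "\<And>t y. t \<in> {a..b} - N \<Longrightarrow> y \<in> {l..r} \<Longrightarrow> \<bar>y - t\<bar> < \<delta> t \<Longrightarrow>
         norm (f y - f t - (y - t) *\<^sub>R \<phi> t) \<le> e1 * \<bar>y - t\<bar>"
      by metis
    define \<gamma> where "\<gamma> t = (if t \<in> N then U else if t \<in> {a..b} then ball t (\<delta> t) else UNIV)" for t
    have "gauge \<gamma>" unfolding gauge_def \<gamma>_def using U \<delta>(1) by auto
    then obtain p where p: "p tagged_division_of {a..b}" "\<gamma> fine p"
      by (rule fine_division_exists_real)
    have fin: "finite p" using p by blast
    have pK: "x \<in> K" "K = {Inf K..Sup K}" "Inf K \<le> Sup K" "K \<subseteq> {a..b}" "K \<subseteq> \<gamma> x"
      if xK: "(x, K) \<in> p" for x K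
    proof -
      obtain u v where K: "K = cbox u v" using tagged_division_ofD(4)[OF p(1) xK] by blast
      show "x \<in> K" "K \<subseteq> {a..b}" using tagged_division_ofD(2,3)[OF p(1) xK] by auto
      then have "u \<le> v" using K by auto
      then show "K = {Inf K..Sup K}" "Inf K \<le> Sup K" using K by auto
      show "K \<subseteq> \<gamma> x" using p(2) xK by (auto simp: fine_def)
    qed
    have disj: "{Inf K<..<Sup K} \<inter> {Inf K'<..<Sup K'} = {}"
      if "(x, K) \<in> p" "(x', K') \<in> p" "(x, K) \<noteq> (x', K')" for x K x' K'
    proof -
      have "interior K \<inter> interior K' = {}" using tagged_division_ofD(5)[OF p(1) that] .
      moreover have "interior K = {Inf K<..<Sup K}" "interior K' = {Inf K'<..<Sup K'}"
        using pK(2)[OF that(1)] pK(2)[OF that(2)] interior_atLeastAtMost_real by metis+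
      ultimately show ?thesis by simp
    qed
    let ?len = "\<lambda>(x::real, K::real set). Sup K - Inf K"
    have len: "(\<Sum>i\<in>p. ?len i) = b - a"
      using additive_tagged_division_1[of a b p "\<lambda>x. x"] p ab by simp
    have len0: "?len i \<ge> 0" if "i \<in> p" for i
      using pK(3)[of "fst i" "snd i"] that by (simp add: split_def)
    \<comment> \<open>The lengths add up to b - a, so \<open>c\<close> is a convex combination of
      values of \<open>\<phi>\<close>.\<close>
    define c where "c = (\<Sum>i\<in>p. (?len i / (b - a)) *\<^sub>R \<phi> (fst i))"
    have "c \<in> C" unfolding c_def
    proof (rule convex_sum[OF fin C(2)])
      show "(\<Sum>i\<in>p. ?len i / (b - a)) = 1" using len ab by (simp flip: sum_divide_distrib)
    qed (use \<phi>C len0 ab in auto)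
    \<comment> \<open>The error splits into three times e/3: good tags by differentiability, the
      increments of \<open>f\<close> over bad tags by absolute continuity, and the default values at
      bad tags.\<close>
    moreover have "norm ((f b - f a) - (b - a) *\<^sub>R c) \<le> e"
    proof -
      let ?F = "\<lambda>(x, K). f (Sup K) - f (Inf K) - (Sup K - Inf K) *\<^sub>R \<phi> x"
      define p1 where "p1 = {i\<in>p. fst i \<notin> N}"
      define p2 where "p2 = {i\<in>p. fst i \<in> N}"
      have "(b - a) *\<^sub>R c = (\<Sum>i\<in>p. ?len i *\<^sub>R \<phi> (fst i))"
        using ab by (simp add: c_def scaleR_sum_right)
      then have "(f b - f a) - (b - a) *\<^sub>R c = (\<Sum>i\<in>p. ?F i)"
        using additive_tagged_division_1[of a b p f] p ab
        by (simp add: sum_subtractf split_def)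
      also have "\<dots> = (\<Sum>i\<in>p1. ?F i) + (\<Sum>i\<in>p2. ?F i)"
        using fin by (subst sum.union_disjoint[symmetric]) (auto simp: p1_def p2_def intro: sum.cong)
      finally have "norm ((f b - f a) - (b - a) *\<^sub>R c) \<le> norm (\<Sum>i\<in>p1. ?F i) + norm (\<Sum>i\<in>p2. ?F i)"
        by (simp add: norm_triangle_ineq)
      moreover have "norm (\<Sum>i\<in>p1. ?F i) \<le> e / 3"
      proof -
        have "norm (\<Sum>i\<in>p1. ?F i) \<le> (\<Sum>i\<in>p1. e1 * ?len i)"
        proof (rule sum_norm_le)
          fix i assume "i \<in> p1"
          then obtain x K where i: "i = (x, K)" "(x, K) \<in> p" "x \<notin> N" by (cases i) (auto simp: p1_def)
          note K = pK[OF i(2)]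
          have x: "x \<in> {a..b} - N" using K i by auto
          have "\<gamma> x = ball x (\<delta> x)" using x by (auto simp: \<gamma>_def)
          then have in_ball: "Inf K \<in> ball x (\<delta> x)" "Sup K \<in> ball x (\<delta> x)"
            using K(2,3,5) by (metis atLeastAtMost_iff order_refl subsetD)+
          have in_lr: "Inf K \<in> {l..r}" "Sup K \<in> {l..r}"
            using K(2,3,4) ab by (metis atLeastAtMost_iff order_refl order_trans subsetD)+
          have xK: "Inf K \<le> x" "x \<le> Sup K" using K(1,2) by (metis atLeastAtMost_iff)+
          have "norm (f (Sup K) - f x - (Sup K - x) *\<^sub>R \<phi> x) \<le> e1 * \<bar>Sup K - x\<bar>"
            using \<delta>(2)[OF x in_lr(2)] in_ball by (simp add: dist_real_def abs_minus_commute)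
          moreover have "norm (f (Inf K) - f x - (Inf K - x) *\<^sub>R \<phi> x) \<le> e1 * \<bar>Inf K - x\<bar>"
            using \<delta>(2)[OF x in_lr(1)] in_ball by (simp add: dist_real_def abs_minus_commute)
          moreover have "?F i = (f (Sup K) - f x - (Sup K - x) *\<^sub>R \<phi> x) - (f (Inf K) - f x - (Inf K - x) *\<^sub>R \<phi> x)"
            by (simp add: i algebra_simps)
          ultimately have "norm (?F i) \<le> e1 * \<bar>Sup K - x\<bar> + e1 * \<bar>Inf K - x\<bar>"
            by (simp only:) (rule order_trans[OF norm_triangle_ineq4 add_mono])
          also have "\<dots> = e1 * (Sup K - Inf K)" using xK by (simp add: algebra_simps)
          finally show "norm (?F i) \<le> e1 * ?len i" by (simp add: i)
        qed
        also have "\<dots> = e1 * (\<Sum>i\<in>p1. ?len i)" by (simp add: sum_distrib_left)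
        also have "\<dots> \<le> e1 * (\<Sum>i\<in>p. ?len i)"
          using e1 len0 fin by (intro mult_left_mono sum_mono2) (auto simp: p1_def)
        also have "\<dots> = e / 3" using ab unfolding len e1_def by (simp only: times_divide_eq_left) (auto simp: field_simps)
        finally show ?thesis .
      qed
      moreover have "norm (\<Sum>i\<in>p2. ?F i) \<le> e / 3 + e / 3"
      proof -
        have fin2: "finite p2" using fin by (simp add: p2_def)
        have disj2: "disjoint_family_on (\<lambda>(x, K). {Inf K<..<Sup K}) p2"
          unfolding disjoint_family_on_def using disj by (auto simp: p2_def)
        have "(\<Sum>i\<in>p2. ?len i) = (\<Sum>i\<in>p2. measure lborel (case i of (x, K) \<Rightarrow> {Inf K<..<Sup K}))"
          using pK(3) by (intro sum.cong) (auto simp: p2_def split_def)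
        also have "\<dots> = measure lborel (\<Union>i\<in>p2. case i of (x, K) \<Rightarrow> {Inf K<..<Sup K})"
          using fin2 disj2 pK(3) by (intro measure_finite_Union[symmetric]) (auto simp: p2_def)
        also have "\<dots> \<le> measure lborel U"
        proof (rule measure_mono_fmeasurable)
          show "(\<Union>i\<in>p2. case i of (x, K) \<Rightarrow> {Inf K<..<Sup K}) \<subseteq> U"
          proof (clarify)
            fix x K t assume "(x, K) \<in> p2" and t: "t \<in> {Inf K<..<Sup K}"
            then have "(x, K) \<in> p" "x \<in> N" by (auto simp: p2_def)
            then have "K \<subseteq> U" "K = {Inf K..Sup K}" using pK(2,5)[of x K] by (auto simp: \<gamma>_def)
            then show "t \<in> U" using t by (metis atLeastAtMost_iff greaterThanLessThan_iff less_imp_le subsetD)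
          qed
          show "U \<in> fmeasurable lborel"
            using U(1) \<mu>U by (intro fmeasurableI) (auto simp: less_top[symmetric] intro: less_trans)
          show "(\<Union>i\<in>p2. case i of (x, K) \<Rightarrow> {Inf K<..<Sup K}) \<in> sets lborel"
            using fin2 by (intro sets.finite_UN) auto
        qed
        also have "\<dots> < d'"
        proof -
          have "emeasure lborel U \<noteq> \<infinity>" using \<mu>U by auto
          then have "emeasure lborel U = ennreal (measure lborel U)"
            by (simp add: emeasure_eq_ennreal_measure)
          then show ?thesis using \<mu>U by (simp add: ennreal_less_iff)
        qed
        finally have small: "(\<Sum>i\<in>p2. ?len i) < d'" .
        \<comment> \<open>Absolute continuity speaks of families indexed by an initial segment of
          the naturals, so the bad part of the division is enumerated.\<close>
        obtain h where h: "bij_betw h {..<card p2} p2"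
          using ex_bij_betw_nat_finite[OF fin2] by (auto simp: atLeast0LessThan)
        have hp: "h i \<in> p2" if "i < card p2" for i using h that by (auto simp: bij_betw_def)
        have "(\<Sum>i<card p2. norm (f (Sup (snd (h i))) - f (Inf (snd (h i))))) < e / 3"
        proof (rule d(2))
          show "\<forall>i<card p2. Inf (snd (h i)) \<le> Sup (snd (h i)) \<and> {Inf (snd (h i))..Sup (snd (h i))} \<subseteq> {l..r}"
          proof (intro allI impI)
            fix i assume "i < card p2"
            then have "(fst (h i), snd (h i)) \<in> p" using hp by (auto simp: p2_def)
            from pK(2,3,4)[OF this] ab
            show "Inf (snd (h i)) \<le> Sup (snd (h i)) \<and> {Inf (snd (h i))..Sup (snd (h i))} \<subseteq> {l..r}"
              by auto
          qed
          show "\<forall>i<card p2. \<forall>j<card p2. i \<noteq> j \<longrightarrow>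
            {Inf (snd (h i))<..<Sup (snd (h i))} \<inter> {Inf (snd (h j))<..<Sup (snd (h j))} = {}"
          proof (intro allI impI)
            fix i j assume ij: "i < card p2" "j < card p2" "i \<noteq> j"
            then have "h i \<noteq> h j" using h by (auto simp: bij_betw_def inj_on_def)
            then show "{Inf (snd (h i))<..<Sup (snd (h i))} \<inter> {Inf (snd (h j))<..<Sup (snd (h j))} = {}"
              using hp[OF ij(1)] hp[OF ij(2)] disj[of "fst (h i)" "snd (h i)" "fst (h j)" "snd (h j)"]
              by (auto simp: p2_def prod_eq_iff)
          qed
          have "(\<Sum>i<card p2. Sup (snd (h i)) - Inf (snd (h i))) = (\<Sum>i\<in>p2. ?len i)"
            using sum.reindex_bij_betw[OF h, of ?len] by (simp add: split_def)
          then show "(\<Sum>i<card p2. Sup (snd (h i)) - Inf (snd (h i))) < d" using small d' by simp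
        qed
        moreover have "(\<Sum>i<card p2. norm (f (Sup (snd (h i))) - f (Inf (snd (h i))))) =
            (\<Sum>i\<in>p2. norm (f (Sup (snd i)) - f (Inf (snd i))))"
          using sum.reindex_bij_betw[OF h, of "\<lambda>i. norm (f (Sup (snd i)) - f (Inf (snd i)))"] .
        ultimately have var: "(\<Sum>i\<in>p2. norm (f (Sup (snd i)) - f (Inf (snd i)))) < e / 3" by simp
        have "norm (\<Sum>i\<in>p2. ?F i) \<le> (\<Sum>i\<in>p2. norm (f (Sup (snd i)) - f (Inf (snd i))) + norm c0 * ?len i)"
        proof (rule sum_norm_le)
          fix i assume "i \<in> p2"
          then obtain x K where i: "i = (x, K)" "(x, K) \<in> p" "x \<in> N" by (cases i) (auto simp: p2_def)
          have "norm (?F i) \<le> norm (f (Sup K) - f (Inf K)) + norm ((Sup K - Inf K) *\<^sub>R c0)"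
            using bad[OF i(3)] by (simp add: i norm_triangle_ineq4 del: norm_scaleR)
          then show "norm (?F i) \<le> norm (f (Sup (snd i)) - f (Inf (snd i))) + norm c0 * ?len i"
            using pK(3)[OF i(2)] by (simp add: i mult.commute)
        qed
        also have "\<dots> = (\<Sum>i\<in>p2. norm (f (Sup (snd i)) - f (Inf (snd i)))) + norm c0 * (\<Sum>i\<in>p2. ?len i)"
          by (simp add: sum.distrib sum_distrib_left)
        also have "\<dots> \<le> e / 3 + norm c0 * d'"
          using var small by (intro add_mono mult_left_mono) auto
        finally show ?thesis using d' by simp
      qed
      ultimately show ?thesis by simp
    qed
    ultimately show ?thesis by blast
  qed
  have "(1 / (b - a)) *\<^sub>R (f b - f a) \<in> closure C"
    unfolding closure_approachable
  proof (intro allI impI)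
    fix e :: real assume "e > 0"
    then have "e / 2 * (b - a) > 0" using ab by simp
    then obtain c where c: "c \<in> C" "norm ((f b - f a) - (b - a) *\<^sub>R c) \<le> e / 2 * (b - a)"
      using approx by blast
    have "c - (1 / (b - a)) *\<^sub>R (f b - f a) = - ((1 / (b - a)) *\<^sub>R ((f b - f a) - (b - a) *\<^sub>R c))"
      using ab by (simp add: scaleR_diff_right)
    then have "dist c ((1 / (b - a)) *\<^sub>R (f b - f a)) = norm ((f b - f a) - (b - a) *\<^sub>R c) / (b - a)"
      using ab by (simp add: dist_norm)
    also have "\<dots> \<le> e / 2" using c ab by (simp add: field_simps)
    also have "\<dots> < e" using \<open>e > 0\<close> by simp
    finally show "\<exists>y\<in>C. dist y ((1 / (b - a)) *\<^sub>R (f b - f a)) < e" using c by blast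
  qed
  then show ?thesis using C by simp
qed

section \<open>Integral equations\<close>

lemma norm_integral_le_const:
  fixes f :: "real \<Rightarrow> 'a::euclidean_space"
  assumes "a \<le> b" "f integrable_on {a..b}" and K: "\<And>t. t \<in> {a..b} \<Longrightarrow> norm (f t) \<le> K"
  shows "norm (integral {a..b} f) \<le> K * (b - a)"
proof -
  have "0 \<le> K" using K[of a] assms(1) by (auto intro: order_trans[OF norm_ge_zero])
  then show ?thesis
    using has_integral_bound_real[OF _ finite.emptyI integrable_integral[OF assms(2)]] K assms(1) by auto
qed

lemma integral_exp_weight:
  fixes L :: real
  assumes "L > 0" "a \<le> t"
  shows "((\<lambda>s. exp (2 * L * (s - a))) has_integral (exp (2 * L * (t - a)) - 1) / (2 * L)) {a..t}"
proof -
  have "((\<lambda>s. exp (2 * L * (s - a))) has_integral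
      exp (2 * L * (t - a)) / (2 * L) - exp (2 * L * (a - a)) / (2 * L)) {a..t}"
    using assms
    by (intro fundamental_theorem_of_calculus)
      (auto intro!: derivative_eq_intros simp flip: has_real_derivative_iff_has_vector_derivative)
  then show ?thesis by (simp add: diff_divide_distrib)
qed

text \<open>The exponent is 2 L so that the factor L in the bound, divided by the rate of the
  exponential, leaves exactly 1/2. This is the contraction factor of the Picard iteration.\<close>

lemma norm_integral_le_exp_weight:
  fixes f :: "real \<Rightarrow> 'a::euclidean_space"
  assumes "L > 0" "C \<ge> 0" "a \<le> t" "f integrable_on {a..t}"
    and f: "\<And>s. s \<in> {a..t} \<Longrightarrow> norm (f s) \<le> L * (C * exp (2 * L * (s - a)))"
  shows "norm (integral {a..t} f) \<le> C / 2 * exp (2 * L * (t - a))"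
proof -
  have int: "((\<lambda>s. L * (C * exp (2 * L * (s - a)))) has_integral
      L * (C * ((exp (2 * L * (t - a)) - 1) / (2 * L)))) {a..t}"
    using integral_exp_weight[OF assms(1,3)] by (intro has_integral_mult_right)
  then have "norm (integral {a..t} f) \<le> integral {a..t} (\<lambda>s. L * (C * exp (2 * L * (s - a))))"
    using assms by (intro integral_norm_bound_integral) auto
  also have "\<dots> = L * (C * ((exp (2 * L * (t - a)) - 1) / (2 * L)))"
    using int by (rule integral_unique)
  also have "\<dots> = C / 2 * (exp (2 * L * (t - a)) - 1)" using assms by (simp add: field_simps)
  also have "\<dots> \<le> C / 2 * exp (2 * L * (t - a))" using assms by (intro mult_left_mono) auto
  finally show ?thesis .
qed

text \<open>Apply the hypothesis at a point where \<phi> divided by the exponential weight attains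
  its maximum m: the integral gives back at most m/2 times the weight, so m \<le> \<eta> + m/2. The
  factor 2 in the conclusion comes from this. A negative m is treated apart, as \<phi> may be
  negative.\<close>

lemma gronwall_weighted:
  fixes \<phi> :: "real \<Rightarrow> real"
  assumes L: "L > 0" and cont: "continuous_on {a..b} \<phi>"
    and le: "\<And>t. t \<in> {a..b} \<Longrightarrow> \<phi> t \<le> \<eta> + L * integral {a..t} \<phi>"
    and \<eta>: "\<eta> \<ge> 0" and t: "t \<in> {a..b}"
  shows "\<phi> t \<le> 2 * \<eta> * exp (2 * L * (t - a))"
proof -
  have "continuous_on {a..b} (\<lambda>s. \<phi> s / exp (2 * L * (s - a)))"
    by (intro continuous_intros cont) auto
  moreover have "{a..b} \<noteq> {}" using t by auto
  ultimately have "\<exists>s\<in>{a..b}. \<forall>r\<in>{a..b}. \<phi> r / exp (2 * L * (r - a)) \<le> \<phi> s / exp (2 * L * (s - a))"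
    by (intro continuous_attains_sup compact_Icc)
  then obtain s where s: "s \<in> {a..b}" and
    max: "\<And>r. r \<in> {a..b} \<Longrightarrow> \<phi> r / exp (2 * L * (r - a)) \<le> \<phi> s / exp (2 * L * (s - a))"
    by blast
  define m where "m = \<phi> s / exp (2 * L * (s - a))"
  have \<phi>m: "\<phi> r \<le> m * exp (2 * L * (r - a))" if "r \<in> {a..b}" for r
    using max[OF that] unfolding m_def[symmetric] by (simp only: pos_divide_le_eq exp_gt_zero)
  have "m \<le> 2 * \<eta>"
  proof (cases "m \<ge> 0")
    case True
    have cs: "continuous_on {a..s} \<phi>" using cont s by (auto intro: continuous_on_subset)
    have int: "((\<lambda>r. m * exp (2 * L * (r - a))) has_integral m * ((exp (2 * L * (s - a)) - 1) / (2 * L))) {a..s}"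
      using integral_exp_weight[OF L, of a s] s by (intro has_integral_mult_right) auto
    have "integral {a..s} \<phi> \<le> integral {a..s} (\<lambda>r. m * exp (2 * L * (r - a)))"
      using \<phi>m s int by (intro integral_le integrable_continuous_real[OF cs]) auto
    also have "\<dots> = m * ((exp (2 * L * (s - a)) - 1) / (2 * L))" using int by (rule integral_unique)
    finally have "\<phi> s \<le> \<eta> + L * (m * ((exp (2 * L * (s - a)) - 1) / (2 * L)))"
      using le[OF s] mult_left_mono[of "integral {a..s} \<phi>" _ L] L by (meson add_left_mono less_imp_le order_trans)
    also have "\<dots> = \<eta> + m * exp (2 * L * (s - a)) / 2 - m / 2" using L by (simp add: field_simps)
    also have "\<dots> \<le> \<eta> * exp (2 * L * (s - a)) + m * exp (2 * L * (s - a)) / 2"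
    proof -
      have "1 \<le> exp (2 * L * (s - a))" using L s by auto
      then have "\<eta> \<le> \<eta> * exp (2 * L * (s - a))" using \<eta> by (simp add: mult_le_cancel_left1)
      then show ?thesis using True by simp
    qed
    finally have "\<phi> s \<le> (\<eta> + m / 2) * exp (2 * L * (s - a))" by (simp add: algebra_simps)
    then have "m \<le> \<eta> + m / 2" 
      unfolding m_def by (simp only: pos_divide_le_eq exp_gt_zero)
    then show ?thesis by simp
  qed (use \<eta> in simp)
  then have "m * exp (2 * L * (t - a)) \<le> 2 * \<eta> * exp (2 * L * (t - a))"
    by (intro mult_right_mono) auto
  with \<phi>m[OF t] show ?thesis by linarith
qed

text \<open>Picard iteration; in the norm weighted by \<open>exp (-2 L (t - a))\<close> it contracts by \<open>1/2\<close> on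
  the whole interval.\<close>

lemma picard_integral_equation:
  fixes G :: "real \<Rightarrow> 'a::euclidean_space \<Rightarrow> 'a"
  assumes L: "L > 0"
    and lip: "\<And>t x y. t \<in> {a..b} \<Longrightarrow> norm (G t x - G t y) \<le> L * norm (x - y)"
    and int: "\<And>w. continuous_on {a..b} w \<Longrightarrow> (\<lambda>t. G t (w t)) integrable_on {a..b}"
  obtains w where "continuous_on {a..b} w"
    "\<And>t. t \<in> {a..b} \<Longrightarrow> w t = x0 + integral {a..t} (\<lambda>s. G s (w s))"
proof -
  define W where "W = rec_nat (\<lambda>_. x0) (\<lambda>_ w t. x0 + integral {a..t} (\<lambda>s. G s (w s)))"
  have W0: "W 0 t = x0" and WS: "W (Suc n) t = x0 + integral {a..t} (\<lambda>s. G s (W n s))" for n t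
    by (simp_all add: W_def)
  have cont: "continuous_on {a..b} (W n)" for n
  proof (induction n)
    case 0
    have "W 0 = (\<lambda>_. x0)" using W0 by blast
    then show ?case by simp
  next
    case (Suc n)
    have "W (Suc n) = (\<lambda>t. x0 + integral {a..t} (\<lambda>s. G s (W n s)))" using WS by blast
    then show ?case
      using indefinite_integral_continuous_1[OF int[OF Suc]] by (auto intro!: continuous_intros)
  qed
  have intt: "(\<lambda>s. G s (w s)) integrable_on {a..t}" if "continuous_on {a..b} w" "t \<in> {a..b}" for w t
    using int[OF that(1)] that(2) by (auto intro: integrable_on_subinterval)
  obtain C where C: "C \<ge> 0" "\<And>t. t \<in> {a..b} \<Longrightarrow> norm (W 1 t - W 0 t) \<le> C"
  proof -
    have "compact ((\<lambda>t. W 1 t - W 0 t) ` {a..b})"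
      by (intro compact_continuous_image continuous_intros cont compact_Icc)
    then have "bounded ((\<lambda>t. W 1 t - W 0 t) ` {a..b})" by (rule compact_imp_bounded)
    then obtain C where "\<forall>t\<in>{a..b}. norm (W 1 t - W 0 t) \<le> C"
      unfolding bounded_iff by auto
    then show ?thesis by (intro that[of "max C 0"]) (auto simp: le_max_iff_disj)
  qed
  have step: "norm (W (Suc n) t - W n t) \<le> C * (1/2)^n * exp (2 * L * (t - a))"
    if "t \<in> {a..b}" for n t
    using that
  proof (induction n arbitrary: t)
    case 0
    have "1 \<le> exp (2 * L * (t - a))" using L 0 by auto
    then have "C * 1 \<le> C * exp (2 * L * (t - a))" using C by (intro mult_left_mono) auto
    then show ?case using C(2)[OF 0] by simp
  next
    case (Suc n)
    have "W (Suc (Suc n)) t - W (Suc n) t = integral {a..t} (\<lambda>s. G s (W (Suc n) s)) - integral {a..t} (\<lambda>s. G s (W n s))"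
      by (simp add: WS)
    also have "\<dots> = integral {a..t} (\<lambda>s. G s (W (Suc n) s) - G s (W n s))"
      using intt[OF cont Suc.prems] by (intro integral_diff[symmetric])
    finally have "norm (W (Suc (Suc n)) t - W (Suc n) t) = norm (integral {a..t} (\<lambda>s. G s (W (Suc n) s) - G s (W n s)))"
      by simp
    also have "\<dots> \<le> (C * (1/2)^n) / 2 * exp (2 * L * (t - a))"
    proof (rule norm_integral_le_exp_weight[OF L])
      show "(\<lambda>s. G s (W (Suc n) s) - G s (W n s)) integrable_on {a..t}"
        using intt[OF cont Suc.prems] by (intro integrable_diff)
      fix s assume "s \<in> {a..t}"
      then have s: "s \<in> {a..b}" using Suc.prems by auto
      then show "norm (G s (W (Suc n) s) - G s (W n s)) \<le> L * (C * (1/2)^n * exp (2 * L * (s - a)))"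
        using L by (intro order_trans[OF lip[OF s] mult_left_mono[OF Suc.IH[OF s]]]) simp
    qed (use C Suc.prems in auto)
    finally show ?case by simp
  qed
  have "uniform_limit {a..b} (\<lambda>n t. \<Sum>i<n. W (Suc i) t - W i t) (\<lambda>t. \<Sum>i. W (Suc i) t - W i t) sequentially"
  proof (rule Weierstrass_m_test)
    show "norm (W (Suc n) t - W n t) \<le> C * (1/2)^n * exp (2 * L * (b - a))" if "t \<in> {a..b}" for n t
    proof -
      have "C * (1/2)^n * exp (2 * L * (t - a)) \<le> C * (1/2)^n * exp (2 * L * (b - a))"
        using C L that by (intro mult_left_mono) auto
      with step[OF that, of n] show ?thesis by linarith
    qed
    show "summable (\<lambda>n. C * (1/2)^n * exp (2 * L * (b - a)))"
      by (intro summable_mult summable_mult2 summable_geometric) auto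
  qed
  then have "uniform_limit {a..b} (\<lambda>n t. x0 + (\<Sum>i<n. W (Suc i) t - W i t))
      (\<lambda>t. x0 + (\<Sum>i. W (Suc i) t - W i t)) sequentially"
    by (intro uniform_limit_add uniform_limit_const)
  moreover define w where "w t = x0 + (\<Sum>i. W (Suc i) t - W i t)" for t
  moreover have "(\<lambda>n t. x0 + (\<Sum>i<n. W (Suc i) t - W i t)) = W"
  proof (intro ext)
    fix n t
    show "x0 + (\<Sum>i<n. W (Suc i) t - W i t) = W n t"
      using sum_lessThan_telescope[of "\<lambda>i. W i t" n] W0 by simp
  qed
  ultimately have lim: "uniform_limit {a..b} W w sequentially" by (simp add: w_def[abs_def])
  have wcont: "continuous_on {a..b} w"
    by (rule uniform_limit_theorem[OF _ lim]) (auto simp: cont)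
  show ?thesis
  proof (rule that[OF wcont])
    fix t assume t: "t \<in> {a..b}"
    have approx: "norm (w t - (x0 + integral {a..t} (\<lambda>s. G s (w s)))) \<le> e" if e: "e > 0" for e
    proof -
      \<comment> \<open>Two errors must fit into e: the distance from \<open>w\<close> to the
        iterate \<open>W (Suc n)\<close>, and L (b - a) times the distance from \<open>w\<close> to
        \<open>W n\<close> under the integral.\<close>
      define K where "K = 1 + L * (b - a)"
      have K: "K > 0" using L t by (auto simp: K_def intro!: add_pos_nonneg)
      then have "e / K > 0" using e by simp
      then have "\<forall>\<^sub>F n in sequentially. \<forall>s\<in>{a..b}. dist (W n s) (w s) < e / K"
        using lim by (auto simp: uniform_limit_iff)
      then obtain n where n: "\<And>m s. m \<ge> n \<Longrightarrow> s \<in> {a..b} \<Longrightarrow> dist (W m s) (w s) < e / K"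
        unfolding eventually_sequentially by blast
      have "norm (integral {a..t} (\<lambda>s. G s (W n s)) - integral {a..t} (\<lambda>s. G s (w s)))
          = norm (integral {a..t} (\<lambda>s. G s (W n s) - G s (w s)))"
        using intt[OF cont t] intt[OF wcont t] by (subst integral_diff) auto
      also have "\<dots> \<le> L * (e / K) * (t - a)"
      proof (rule norm_integral_le_const)
        show "t \<ge> a" using t by simp
        show "(\<lambda>s. G s (W n s) - G s (w s)) integrable_on {a..t}"
          using intt[OF cont t] intt[OF wcont t] by (intro integrable_diff)
        show "norm (G s (W n s) - G s (w s)) \<le> L * (e / K)" if "s \<in> {a..t}" for s
        proof -
          have s: "s \<in> {a..b}" using that t by auto
          have "L * norm (W n s - w s) \<le> L * (e / K)"
            using n[of n s] s L by (intro mult_left_mono) (auto simp: dist_norm)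
          then show ?thesis using lip[OF s, of "W n s" "w s"] by linarith
        qed
      qed
      also have "\<dots> \<le> L * (e / K) * (b - a)"
        using t L e K by (intro mult_left_mono) auto
      finally have 1: "norm (integral {a..t} (\<lambda>s. G s (W n s)) - integral {a..t} (\<lambda>s. G s (w s))) \<le> L * (e / K) * (b - a)" .
      have 2: "norm (w t - W (Suc n) t) \<le> e / K"
        using n[of "Suc n" t] t by (simp add: dist_norm norm_minus_commute)
      have eq: "w t - (x0 + integral {a..t} (\<lambda>s. G s (w s))) = (w t - W (Suc n) t) +
          (integral {a..t} (\<lambda>s. G s (W n s)) - integral {a..t} (\<lambda>s. G s (w s)))" by (simp add: WS)
      have "norm (w t - (x0 + integral {a..t} (\<lambda>s. G s (w s)))) \<le> e / K + L * (e / K) * (b - a)"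
        unfolding eq by (rule order_trans[OF norm_triangle_ineq add_mono[OF 2 1]])
      also have "x + L * x * (b - a) = x * K" for x by (simp add: K_def algebra_simps)
      also have "e / K * K = e" using K by simp
      finally show ?thesis .
    qed
    have "norm (w t - (x0 + integral {a..t} (\<lambda>s. G s (w s)))) \<le> 0"
      by (rule field_le_epsilon) (simp only: add_0 approx)
    then show "w t = x0 + integral {a..t} (\<lambda>s. G s (w s))" by simp
  qed
qed

text \<open>Right-hand sides along a piecewise constant control are continuous in time except at its
  finitely many jumps, and bounded; the jumps are a negligible set.\<close>

lemma integrable_continuous_off_finite:
  fixes f :: "real \<Rightarrow> 'a::euclidean_space"
  assumes "finite S" "continuous_on ({a..b} - S) f"
    and bd: "\<And>t. t \<in> {a..b} \<Longrightarrow> norm (f t) \<le> K"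
  shows "f integrable_on {a..b}"
proof -
  have S: "{a..b} - S \<in> lmeasurable"
    using assms(1) by (intro fmeasurable.Diff) (auto simp: negligible_finite negligible_imp_measurable)
  have "f \<in> borel_measurable (lebesgue_on ({a..b} - S))"
    using assms(2) S by (intro continuous_imp_measurable_on_sets_lebesgue) auto
  moreover have "(\<lambda>_. K) integrable_on ({a..b} - S)"
    using S by (simp add: integrable_on_const)
  ultimately have "f integrable_on ({a..b} - S)"
    by (rule measurable_bounded_by_integrable_imp_integrable) (use S bd in \<open>simp_all add: fmeasurableD\<close>)
  then show ?thesis
    by (rule integrable_spike_set) (auto intro: negligible_subset[OF negligible_finite[OF assms(1)]])
qed

section \<open>Linear control systems with piecewise constant controls\<close>

text \<open>Local constancy off a finite set replaces a list of breakpoints, which makes sums and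
  concatenations easy. The filter is relative to \<open>X\<close>, so one-sided constancy is enough
  at the ends of an interval. The bound also covers the values at exceptional points.\<close>

definition pw_const :: "real set \<Rightarrow> (real \<Rightarrow> 'u::real_normed_vector) \<Rightarrow> bool" where
  "pw_const X u \<longleftrightarrow> bounded (u ` X) \<and>
     (\<exists>S. finite S \<and> (\<forall>t\<in>X - S. \<forall>\<^sub>F s in at t within X. u s = u t))"

lemma pw_const_const: "pw_const X (\<lambda>_. c)"
  by (auto simp: pw_const_def bounded_iff intro!: exI[of _ "{}"])

lemma pw_const_lincomb:
  assumes "pw_const X u" "pw_const X v"
  shows "pw_const X (\<lambda>t. \<alpha> *\<^sub>R u t + v t)"
proof -
  obtain S1 S2 where S: "finite S1" "finite S2"
    "\<And>t. t \<in> X - S1 \<Longrightarrow> \<forall>\<^sub>F s in at t within X. u s = u t"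
    "\<And>t. t \<in> X - S2 \<Longrightarrow> \<forall>\<^sub>F s in at t within X. v s = v t"
    using assms unfolding pw_const_def by blast
  obtain K1 K2 where K: "\<And>t. t \<in> X \<Longrightarrow> norm (u t) \<le> K1" "\<And>t. t \<in> X \<Longrightarrow> norm (v t) \<le> K2"
    using assms unfolding pw_const_def bounded_iff by fast
  show ?thesis
    unfolding pw_const_def
  proof (intro conjI exI[of _ "S1 \<union> S2"] ballI)
    have "norm (\<alpha> *\<^sub>R u t + v t) \<le> \<bar>\<alpha>\<bar> * K1 + K2" if "t \<in> X" for t
      using norm_triangle_ineq[of "\<alpha> *\<^sub>R u t" "v t"] K[OF that] mult_left_mono[OF K(1)[OF that], of "\<bar>\<alpha>\<bar>"]
      by simp
    then show "bounded ((\<lambda>t. \<alpha> *\<^sub>R u t + v t) ` X)" unfolding bounded_iff by blast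
    fix t assume "t \<in> X - (S1 \<union> S2)"
    then have "t \<in> X - S1" "t \<in> X - S2" by auto
    from S(3)[OF this(1)] S(4)[OF this(2)]
    show "\<forall>\<^sub>F s in at t within X. \<alpha> *\<^sub>R u s + v s = \<alpha> *\<^sub>R u t + v t"
      by eventually_elim simp
  qed (use S in auto)
qed

text \<open>Near t the control can be replaced by its value \<open>u t\<close>. Hence
  \<open>H\<close> has to be continuous in time only, with no regularity in its first argument; this
  is how a \<open>g\<close> that may be discontinuous in the control is handled.\<close>

lemma continuous_within_comp_locally_const:
  assumes "\<forall>\<^sub>F s in at t within X. u s = u t" "continuous (at t within X) (H (u t))"
  shows "continuous (at t within X) (\<lambda>s. H (u s) s)"
proof -
  have "(H (u t) \<longlongrightarrow> H (u t) t) (at t within X)" using assms(2) by (simp add: continuous_within)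
  moreover have "\<forall>\<^sub>F s in at t within X. H (u t) s = H (u s) s"
    using assms(1) by eventually_elim simp
  ultimately show ?thesis unfolding continuous_within by (rule Lim_transform_eventually)
qed

lemma at_within_Icc_eq:
  fixes t :: real
  assumes "c \<in> {a..b}" "t \<noteq> c" "t \<in> {a..b}"
  shows "at t within {a..b} = (if t < c then at t within {a..c} else at t within {c..b})"
proof (cases "t < c")
  case True
  have "at t within {a..b} = at t within {a..c}"
    by (rule at_within_nhd[of t "{..<c}"]) (use True assms in auto)
  then show ?thesis using True by simp
next
  case False
  have "at t within {a..b} = at t within {c..b}"
    by (rule at_within_nhd[of t "{c<..}"]) (use False assms in auto)
  then show ?thesis using False by simp
qed

text \<open>At c itself the first piece wins. For trajectories this is harmless because the pieces
  agree at c; for controls c joins the exceptional set.\<close>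

definition join_at :: "real \<Rightarrow> (real \<Rightarrow> 'a) \<Rightarrow> (real \<Rightarrow> 'a) \<Rightarrow> real \<Rightarrow> 'a" where
  "join_at c f1 f2 t = (if t \<le> c then f1 t else f2 t)"

lemma eventually_join_at:
  assumes c: "c \<in> {a..b}" and t: "t \<in> {a..b}" "t \<noteq> c"
    and "t < c \<Longrightarrow> \<forall>\<^sub>F s in at t within {a..c}. f1 s = f1 t"
    and "c < t \<Longrightarrow> \<forall>\<^sub>F s in at t within {c..b}. f2 s = f2 t"
  shows "\<forall>\<^sub>F s in at t within {a..b}. join_at c f1 f2 s = join_at c f1 f2 t"
proof (cases "t < c")
  case True
  have "\<forall>\<^sub>F s in at t within {a..c}. s \<in> {a..c}" by (auto simp: eventually_at_filter)
  with assms(4)[OF True] have "\<forall>\<^sub>F s in at t within {a..c}. join_at c f1 f2 s = join_at c f1 f2 t"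
    by eventually_elim (use True in \<open>auto simp: join_at_def\<close>)
  then show ?thesis using True by (simp add: at_within_Icc_eq[OF c t(2,1)])
next
  case False
  have "\<forall>\<^sub>F s in at t within {c..b}. s \<in> {c<..}"
    using False t by (intro eventually_at_topological[THEN iffD2] exI[of _ "{c<..}"]) auto
  moreover have "\<forall>\<^sub>F s in at t within {c..b}. f2 s = f2 t" using assms(5) False t by simp
  ultimately have "\<forall>\<^sub>F s in at t within {c..b}. join_at c f1 f2 s = join_at c f1 f2 t"
    by eventually_elim (use False t in \<open>auto simp: join_at_def\<close>)
  then show ?thesis using False by (simp add: at_within_Icc_eq[OF c t(2,1)])
qed

lemma pw_const_join:
  assumes c: "c \<in> {a..b}" and u: "pw_const {a..c} u1" "pw_const {c..b} u2"
  shows "pw_const {a..b} (join_at c u1 u2)"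
proof -
  obtain S1 S2 where S: "finite S1" "finite S2"
    "\<And>t. t \<in> {a..c} - S1 \<Longrightarrow> \<forall>\<^sub>F s in at t within {a..c}. u1 s = u1 t"
    "\<And>t. t \<in> {c..b} - S2 \<Longrightarrow> \<forall>\<^sub>F s in at t within {c..b}. u2 s = u2 t"
    using u unfolding pw_const_def by blast
  show ?thesis
    unfolding pw_const_def
  proof (intro conjI exI[of _ "S1 \<union> S2 \<union> {c}"] ballI)
    have "join_at c u1 u2 ` {a..b} \<subseteq> u1 ` {a..c} \<union> u2 ` {c..b}" by (auto simp: join_at_def)
    then show "bounded (join_at c u1 u2 ` {a..b})"
      using u unfolding pw_const_def by (meson bounded_Un bounded_subset)
    fix t assume "t \<in> {a..b} - (S1 \<union> S2 \<union> {c})"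
    then show "\<forall>\<^sub>F s in at t within {a..b}. join_at c u1 u2 s = join_at c u1 u2 t"
      by (intro eventually_join_at[OF c] S) auto
  qed (use S in auto)
qed

lemma continuous_on_join_at:
  fixes y1 y2 :: "real \<Rightarrow> 'a::topological_space"
  assumes c: "c \<in> {a..b}" and "continuous_on {a..c} y1" "continuous_on {c..b} y2" "y1 c = y2 c"
  shows "continuous_on {a..b} (join_at c y1 y2)"
proof -
  have "continuous_on ({a..c} \<union> {c..b}) (\<lambda>t. if t \<le> c then y1 t else y2 t)"
    using assms by (intro continuous_on_If) auto
  moreover have "{a..c} \<union> {c..b} = {a..b}" using c by auto
  ultimately show ?thesis by (simp add: join_at_def[abs_def])
qed

lemma has_vector_derivative_join_at:
  assumes c: "c \<in> {a..b}" and t: "t \<in> {a..b}" "t \<noteq> c"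
    and 1: "t < c \<Longrightarrow> (y1 has_vector_derivative D) (at t within {a..c})"
    and 2: "c < t \<Longrightarrow> (y2 has_vector_derivative D) (at t within {c..b})"
    and join: "y1 c = y2 c"
  shows "(join_at c y1 y2 has_vector_derivative D) (at t within {a..b})"
proof (cases "t < c")
  case True
  have "(join_at c y1 y2 has_vector_derivative D) (at t within {a..c})"
    by (rule has_vector_derivative_transform[OF _ _ 1[OF True]]) (use True t in \<open>auto simp: join_at_def\<close>)
  then show ?thesis using True by (simp add: at_within_Icc_eq[OF c t(2,1)])
next
  case False
  then have "c < t" using t by simp
  have "(join_at c y1 y2 has_vector_derivative D) (at t within {c..b})"
    by (rule has_vector_derivative_transform[OF _ _ 2[OF \<open>c < t\<close>]]) (use False t join in \<open>auto simp: join_at_def\<close>)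
  then show ?thesis using False by (simp add: at_within_Icc_eq[OF c t(2,1)])
qed

text \<open>\<open>A\<close> and \<open>B\<close> are arbitrary maps instead of matrices, so that
  scaled matrices, adjoints and the zero map can be inserted. Continuity of \<open>y\<close> on all
  of \<open>X\<close> rules out jumps at the exceptional points of the differential
  equation.\<close>

definition ctrl_sol ::
  "('y \<Rightarrow> 'y) \<Rightarrow> ('u \<Rightarrow> 'y) \<Rightarrow> real set \<Rightarrow> (real \<Rightarrow> 'u::euclidean_space) \<Rightarrow> (real \<Rightarrow> 'y::euclidean_space) \<Rightarrow> bool" where
  "ctrl_sol A B X u y \<longleftrightarrow> pw_const X u \<and> continuous_on X y \<and>
     (\<exists>S. finite S \<and> (\<forall>t\<in>X - S. (y has_vector_derivative A (y t) + B (u t)) (at t within X)))"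

lemma ctrl_sol_join:
  assumes c: "c \<in> {a..b}" and 1: "ctrl_sol A B {a..c} u1 y1" and 2: "ctrl_sol A B {c..b} u2 y2"
    and eq: "y1 c = y2 c"
  shows "ctrl_sol A B {a..b} (join_at c u1 u2) (join_at c y1 y2)"
proof -
  obtain S1 S2 where S: "finite S1" "finite S2"
    "\<And>t. t \<in> {a..c} - S1 \<Longrightarrow> (y1 has_vector_derivative A (y1 t) + B (u1 t)) (at t within {a..c})"
    "\<And>t. t \<in> {c..b} - S2 \<Longrightarrow> (y2 has_vector_derivative A (y2 t) + B (u2 t)) (at t within {c..b})"
    using 1 2 unfolding ctrl_sol_def by blast
  have "(join_at c y1 y2 has_vector_derivative A (join_at c y1 y2 t) + B (join_at c u1 u2 t)) (at t within {a..b})"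
    if t: "t \<in> {a..b} - (S1 \<union> S2 \<union> {c})" for t
  proof (rule has_vector_derivative_join_at[OF c])
    show "(y1 has_vector_derivative A (join_at c y1 y2 t) + B (join_at c u1 u2 t)) (at t within {a..c})" if "t < c"
      using S(3)[of t] that t by (simp add: join_at_def)
    show "(y2 has_vector_derivative A (join_at c y1 y2 t) + B (join_at c u1 u2 t)) (at t within {c..b})" if "c < t"
      using S(4)[of t] that t by (simp add: join_at_def)
  qed (use t eq in auto)
  moreover have "finite (S1 \<union> S2 \<union> {c})" using S by simp
  moreover have "pw_const {a..b} (join_at c u1 u2)" "continuous_on {a..b} (join_at c y1 y2)"
    using 1 2 by (auto simp: ctrl_sol_def intro!: pw_const_join[OF c] continuous_on_join_at[OF c] eq)
  ultimately show ?thesis unfolding ctrl_sol_def by (intro conjI exI[of _ "S1 \<union> S2 \<union> {c}"] ballI)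
qed

lemma ctrl_sol_lincomb:
  assumes "linear A" "linear B" "ctrl_sol A B X u1 y1" "ctrl_sol A B X u2 y2"
  shows "ctrl_sol A B X (\<lambda>t. \<alpha> *\<^sub>R u1 t + u2 t) (\<lambda>t. \<alpha> *\<^sub>R y1 t + y2 t)"
proof -
  obtain S1 S2 where S: "finite S1" "finite S2"
    "\<And>t. t \<in> X - S1 \<Longrightarrow> (y1 has_vector_derivative A (y1 t) + B (u1 t)) (at t within X)"
    "\<And>t. t \<in> X - S2 \<Longrightarrow> (y2 has_vector_derivative A (y2 t) + B (u2 t)) (at t within X)"
    using assms(3,4) unfolding ctrl_sol_def by blast
  have "((\<lambda>t. \<alpha> *\<^sub>R y1 t + y2 t) has_vector_derivative
      A (\<alpha> *\<^sub>R y1 t + y2 t) + B (\<alpha> *\<^sub>R u1 t + u2 t)) (at t within X)"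
    if "t \<in> X - (S1 \<union> S2)" for t
  proof -
    have "((\<lambda>t. \<alpha> *\<^sub>R y1 t + y2 t) has_vector_derivative
      \<alpha> *\<^sub>R (A (y1 t) + B (u1 t)) + (A (y2 t) + B (u2 t))) (at t within X)"
      by (rule has_vector_derivative_add[OF bounded_linear.has_vector_derivative[OF bounded_linear_scaleR_right S(3)] S(4)])
         (use that in auto)
    then show ?thesis
      by (simp add: linear_add[OF assms(1)] linear_add[OF assms(2)] linear_cmul[OF assms(1)]
          linear_cmul[OF assms(2)] scaleR_add_right add_ac)
  qed
  moreover have "finite (S1 \<union> S2)" using S by simp
  ultimately show ?thesis
    using assms(3,4) pw_const_lincomb unfolding ctrl_sol_def
    by (intro conjI exI[of _ "S1 \<union> S2"]) (auto intro!: continuous_intros pw_const_lincomb)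
qed

lemma linear_ode_integrable:
  fixes A :: "'y::euclidean_space \<Rightarrow> 'y" and B :: "'u::euclidean_space \<Rightarrow> 'y"
  assumes lin: "linear A" "linear B" and u: "pw_const {a..b} u" and w: "continuous_on {a..b} w"
  shows "(\<lambda>t. A (w t) + B (u t)) integrable_on {a..b}"
proof -
  obtain S where S: "finite S" "\<And>t. t \<in> {a..b} - S \<Longrightarrow> \<forall>\<^sub>F s in at t within {a..b}. u s = u t"
    using u unfolding pw_const_def by blast
  have cA: "continuous_on {a..b} (\<lambda>t. A (w t))" by (rule linear_continuous_on_compose[OF w lin(1)])
  have "continuous_on ({a..b} - S) (\<lambda>t. B (u t))"
    unfolding continuous_on_eq_continuous_within
  proof
    fix t assume "t \<in> {a..b} - S"
    then have "continuous (at t within {a..b}) (\<lambda>s. B (u s))"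
      by (rule continuous_within_comp_locally_const[where H="\<lambda>v s. B v", OF S(2) continuous_const])
    then show "continuous (at t within {a..b} - S) (\<lambda>s. B (u s))"
      by (rule continuous_within_subset) auto
  qed
  moreover obtain K1 where K1: "\<And>t. t \<in> {a..b} \<Longrightarrow> norm (B (u t)) \<le> K1"
  proof -
    have "bounded (B ` (u ` {a..b}))"
      using u lin(2) unfolding pw_const_def linear_conv_bounded_linear by (blast intro: bounded_linear_image)
    then show ?thesis using that unfolding bounded_iff by fast
  qed
  ultimately have "(\<lambda>t. B (u t)) integrable_on {a..b}"
    by (intro integrable_continuous_off_finite[OF S(1)])
  then show ?thesis using integrable_continuous_real[OF cA] by (intro integrable_add)
qed

text \<open>The last conclusion names the times at which the equation holds: wherever the control is
  locally constant. For a constant control these are all times, which the existential exceptional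
  set in \<open>ctrl_sol\<close> would not reveal.\<close>

lemma ctrl_sol_exists:
  fixes A :: "'y::euclidean_space \<Rightarrow> 'y" and B :: "'u::euclidean_space \<Rightarrow> 'y"
  assumes lin: "linear A" "linear B" and u: "pw_const {a..b} u" and ab: "a \<le> b"
  obtains y where "ctrl_sol A B {a..b} u y" "y a = ya"
    "\<And>t. t \<in> {a..b} \<Longrightarrow> \<forall>\<^sub>F s in at t within {a..b}. u s = u t \<Longrightarrow>
       (y has_vector_derivative A (y t) + B (u t)) (at t within {a..b})"
proof -
  obtain L where L: "L > 0" "\<And>x. norm (A x) \<le> L * norm x"
    using linear_bounded_pos[OF lin(1)] by blast
  have "norm (A x + B (u t) - (A y + B (u t))) \<le> L * norm (x - y)" for t x y
    using L(2)[of "x - y"] linear_diff[OF lin(1), of x y] by simp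
  then obtain y where y: "continuous_on {a..b} y"
    "\<And>t. t \<in> {a..b} \<Longrightarrow> y t = ya + integral {a..t} (\<lambda>s. A (y s) + B (u s))"
    using picard_integral_equation[OF L(1), of a b "\<lambda>t x. A x + B (u t)" ya]
      linear_ode_integrable[OF lin u] by blast
  obtain S where S: "finite S" "\<And>t. t \<in> {a..b} - S \<Longrightarrow> \<forall>\<^sub>F s in at t within {a..b}. u s = u t"
    using u unfolding pw_const_def by blast
  have deriv: "(y has_vector_derivative A (y t) + B (u t)) (at t within {a..b})"
    if t: "t \<in> {a..b}" "\<forall>\<^sub>F s in at t within {a..b}. u s = u t" for t
  proof -
    have "continuous (at t within {a..b}) y" using y t by (simp add: continuous_on_eq_continuous_within)
    then have "continuous (at t within {a..b}) (\<lambda>s. A (y s))"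
      using lin(1) by (auto simp: linear_conv_bounded_linear intro: bounded_linear.continuous)
    then have "continuous (at t within {a..b}) (\<lambda>s. A (y s) + B (u s))"
      by (intro continuous_within_comp_locally_const[where H="\<lambda>v s. A (y s) + B v", OF t(2)]
          continuous_add continuous_const)
    then have "((\<lambda>t. integral {a..t} (\<lambda>s. A (y s) + B (u s))) has_vector_derivative A (y t) + B (u t)) (at t within {a..b})"
      using integral_has_vector_derivative_continuous_at[OF linear_ode_integrable[OF lin u y(1)], of t "{}"] t by simp
    then have "((\<lambda>t. ya + integral {a..t} (\<lambda>s. A (y s) + B (u s))) has_vector_derivative A (y t) + B (u t)) (at t within {a..b})"
      by (auto intro!: derivative_eq_intros)
    then show ?thesis
      using t y(2) by (intro has_vector_derivative_transform[of t "{a..b}" y]) auto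
  qed
  have "ctrl_sol A B {a..b} u y" using u y(1) S(1) deriv[OF _ S(2)] unfolding ctrl_sol_def by blast
  moreover have "y a = ya" using y(2)[of a] ab by simp
  ultimately show ?thesis using deriv by (rule that)
qed

text \<open>The reflection of time t to a + b - t turns the terminal condition into an initial one
  and changes the sign of the derivative.\<close>

lemma adjoint_ode_backward:
  fixes A :: "'y::euclidean_space \<Rightarrow> 'y"
  assumes lin: "linear A" and ab: "a \<le> b"
  obtains q where "q b = p"
    "\<And>t. t \<in> {a..b} \<Longrightarrow> (q has_vector_derivative - adjoint A (q t)) (at t within {a..b})"
proof -
  obtain r where r: "r a = p"
    "\<And>t. t \<in> {a..b} \<Longrightarrow> (r has_vector_derivative adjoint A (r t)) (at t within {a..b})"
    by (rule ctrl_sol_exists[of "adjoint A" "\<lambda>_::real. 0" a b "\<lambda>_. 0" p])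
       (use ab in \<open>auto simp: adjoint_linear[OF lin] linear_zero pw_const_const\<close>)
  have img: "(\<lambda>t. a + b - t) ` {a..b} = {a..b}"
    using image_diff_atLeastAtMost[of "a + b" a b] ab by simp
  show ?thesis
  proof (rule that[of "r \<circ> (\<lambda>t. a + b - t)"])
    fix t assume t: "t \<in> {a..b}"
    have "((\<lambda>t. a + b - t) has_vector_derivative -1) (at t within {a..b})"
      by (auto intro!: derivative_eq_intros)
    from vector_diff_chain_within[OF this, of r] r(2)[of "a + b - t"] t
    show "(r \<circ> (\<lambda>t. a + b - t) has_vector_derivative - adjoint A ((r \<circ> (\<lambda>t. a + b - t)) t)) (at t within {a..b})"
      by (simp add: img)
  qed (use r in simp)
qed

lemma has_vector_derivative_zero_on_Icc:
  fixes f :: "real \<Rightarrow> 'a::euclidean_space"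
  assumes "a < b" "t \<in> {a..b}" "\<And>s. s \<in> {a..b} \<Longrightarrow> f s = 0"
    and "(f has_vector_derivative D) (at t within {a..b})"
  shows "D = 0"
proof -
  have "(f has_vector_derivative 0) (at t within {a..b})"
    by (rule has_vector_derivative_transform[of t _ _ "\<lambda>_. 0"]) (use assms in auto)
  then show ?thesis
    using vector_derivative_unique_within_closed_interval[of a b t f D 0] assms by auto
qed

text \<open>If \<open>p\<close> is orthogonal to everything reachable from \<open>0\<close>, then the solution \<open>q\<close> of the adjoint
  equation with \<open>q b = p\<close> satisfies \<open>\<integral> q \<bullet> B u = 0\<close> for all step controls \<open>u\<close>, so \<open>q \<bullet> B v\<close>
  vanishes identically; differentiating repeatedly gives \<open>q \<bullet> A^i B v = 0\<close>.\<close>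

lemma steering_pw_const:
  fixes A :: "'y::euclidean_space \<Rightarrow> 'y" and B :: "'u::euclidean_space \<Rightarrow> 'y"
  assumes lin: "linear A" "linear B"
    and ctrb: "\<And>q. (\<And>i v. q \<bullet> (A ^^ i) (B v) = 0) \<Longrightarrow> q = 0"
    and ab: "a < b"
  obtains u y where "ctrl_sol A B {a..b} u y" "y a = ya" "y b = yb"
proof -
  define R where "R = {y b | u y. ctrl_sol A B {a..b} u y \<and> y a = 0}"
  have comb: "\<alpha> *\<^sub>R x + x' \<in> R" if xx: "x \<in> R" "x' \<in> R" for \<alpha> x x'
  proof -
    obtain u y u' y' where "ctrl_sol A B {a..b} u y" "y a = 0" "x = y b"
      "ctrl_sol A B {a..b} u' y'" "y' a = 0" "x' = y' b"
      using xx unfolding R_def by blast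
    then show ?thesis
      unfolding R_def using ctrl_sol_lincomb[OF lin, of "{a..b}" u y u' y' \<alpha>]
      by (intro CollectI exI[of _ "\<lambda>t. \<alpha> *\<^sub>R u t + u' t"] exI[of _ "\<lambda>t. \<alpha> *\<^sub>R y t + y' t"]) simp
  qed
  have R0: "0 \<in> R"
  proof -
    have "ctrl_sol A B {a..b} (\<lambda>_. 0) (\<lambda>_. 0)"
      unfolding ctrl_sol_def using lin by (auto simp: pw_const_const linear_0)
    then show ?thesis unfolding R_def by auto
  qed
  have sub: "subspace R"
    unfolding subspace_def using comb[of _ _ 1] comb[OF _ R0] R0 by simp
  have "R = UNIV"
  proof (rule ccontr)
    assume "R \<noteq> UNIV"
    then have "R \<subset> UNIV" by (simp add: psubset_eq)
    moreover have "span R = R" using sub by simp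
    ultimately have "span R \<subset> span UNIV" by (simp only: span_UNIV)
    then obtain p where p: "p \<noteq> 0" "\<And>x. x \<in> R \<Longrightarrow> orthogonal p x"
      using orthogonal_to_subspace_exists_gen[of R UNIV] by (metis span_base)
    obtain q where qb: "q b = p" and
      dq: "\<And>t. t \<in> {a..b} \<Longrightarrow> (q has_vector_derivative - adjoint A (q t)) (at t within {a..b})"
      using adjoint_ode_backward[OF lin(1), of a b p] ab by auto
    have qcont: "continuous_on {a..b} q"
      using dq by (meson continuous_on_eq_continuous_within has_vector_derivative_continuous)
    have dinner: "((\<lambda>t. q t \<bullet> w) has_vector_derivative - (q t \<bullet> A w)) (at t within {a..b})"
      if "t \<in> {a..b}" for t w
    proof -
      have "((\<lambda>t. q t \<bullet> w) has_vector_derivative (- adjoint A (q t)) \<bullet> w) (at t within {a..b})"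
        by (rule bounded_linear.has_vector_derivative[OF bounded_linear_inner_left dq[OF that]])
      moreover have "adjoint A (q t) \<bullet> w = q t \<bullet> A w"
        using adjoint_works[OF lin(1), of w "q t"] by (simp add: inner_commute)
      ultimately show ?thesis by simp
    qed
    have int0: "((\<lambda>t. q t \<bullet> B (u t)) has_integral 0) {a..b}" if sol: "ctrl_sol A B {a..b} u y" "y a = 0" for u y
    proof -
      obtain S where S: "finite S"
        "\<And>t. t \<in> {a..b} - S \<Longrightarrow> (y has_vector_derivative A (y t) + B (u t)) (at t within {a..b})"
        using sol unfolding ctrl_sol_def by blast
      have ycont: "continuous_on {a..b} y" using sol unfolding ctrl_sol_def by blast
      \<comment> \<open>In the derivative of the inner product of q and y the terms with
        \<open>A\<close> and its adjoint cancel, leaving only the control term.\<close>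
      have "((\<lambda>t. q t \<bullet> B (u t)) has_integral (q b \<bullet> y b - q a \<bullet> y a)) {a..b}"
      proof (rule fundamental_theorem_of_calculus_interior_strong[OF S(1)])
        fix t assume t: "t \<in> {a<..<b} - S"
        then have at: "at t within {a..b} = at t" by (intro at_within_interior) auto
        have "((\<lambda>t. q t \<bullet> y t) has_vector_derivative
            q t \<bullet> (A (y t) + B (u t)) + (- adjoint A (q t)) \<bullet> y t) (at t within {a..b})"
          by (rule bounded_bilinear.has_vector_derivative[OF bounded_bilinear_inner dq S(2)]) (use t in auto)
        moreover have "adjoint A (q t) \<bullet> y t = q t \<bullet> A (y t)"
          using adjoint_works[OF lin(1), of "y t" "q t"] by (simp add: inner_commute)
        ultimately show "((\<lambda>t. q t \<bullet> y t) has_vector_derivative q t \<bullet> B (u t)) (at t)"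
          by (simp add: at inner_add_right)
      qed (use ab in \<open>auto intro!: continuous_intros qcont ycont\<close>)
      moreover have "y b \<in> R" using sol unfolding R_def by blast
      then have "q b \<bullet> y b = 0" using p(2) qb by (simp add: orthogonal_def)
      ultimately show ?thesis using sol by simp
    qed
    have qB: "q t \<bullet> B v = 0" if t: "t \<in> {a..b}" for t v
    proof -
      have cont: "continuous_on {a..b} (\<lambda>s. q s \<bullet> B v)" by (intro continuous_intros qcont)
      have "integral {a..c} (\<lambda>s. q s \<bullet> B v) = 0" if c: "c \<in> {a..b}" for c
      proof -
        \<comment> \<open>The control equal to v up to c and 0 afterwards isolates the integral from
          a to c. As it vanishes for every c, so does its continuous integrand.\<close>
        have "pw_const {a..b} (join_at c (\<lambda>_. v) (\<lambda>_. 0))"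
          by (intro pw_const_join c pw_const_const)
        then obtain y where "ctrl_sol A B {a..b} (join_at c (\<lambda>_. v) (\<lambda>_. 0)) y" "y a = 0"
          using ctrl_sol_exists[OF lin, of a b _ 0] ab by (metis less_imp_le)
        then have int: "((\<lambda>t. q t \<bullet> B (join_at c (\<lambda>_. v) (\<lambda>_. 0) t)) has_integral 0) {a..b}" by (rule int0)
        have "q s \<bullet> B (join_at c (\<lambda>_. v) (\<lambda>_. 0) s) = (if s \<in> {a..c} then q s \<bullet> B v else 0)"
          if "s \<in> {a..b}" for s using that by (auto simp: join_at_def linear_0[OF lin(2)])
        from has_integral_eq[OF this int]
        have "((\<lambda>s. if s \<in> {a..c} then q s \<bullet> B v else 0) has_integral 0) {a..b}" .
        then have "((\<lambda>s. q s \<bullet> B v) has_integral 0) {a..c}"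
          using c by (subst (asm) has_integral_restrict) auto
        then show ?thesis by (rule integral_unique)
      qed
      from has_vector_derivative_zero_on_Icc[OF ab t this integral_has_vector_derivative[OF cont t]]
      show ?thesis .
    qed
    have "q t \<bullet> (A ^^ i) (B v) = 0" if "t \<in> {a..b}" for t i v
      using that
    proof (induction i arbitrary: t)
      case 0 then show ?case using qB by simp
    next
      case (Suc i)
      have "- (q t \<bullet> A ((A ^^ i) (B v))) = 0"
        by (rule has_vector_derivative_zero_on_Icc[OF ab Suc.prems Suc.IH dinner[OF Suc.prems]])
      then show ?case by simp
    qed
    then have "q b = 0" using ab by (intro ctrb) auto
    then show False using qb p(1) by simp
  qed
  \<comment> \<open>By linearity the uncontrolled motion from \<open>ya\<close> can be superposed
    with a motion from 0 that supplies the missing displacement.\<close>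
  obtain y0 where y0: "ctrl_sol A B {a..b} (\<lambda>_. 0) y0" "y0 a = ya"
    using ctrl_sol_exists[OF lin pw_const_const, of a b 0 ya] ab by auto
  have "yb - y0 b \<in> R" using \<open>R = UNIV\<close> by simp
  then obtain u y where uy: "ctrl_sol A B {a..b} u y" "y a = 0" "yb - y0 b = y b"
    unfolding R_def by blast
  show ?thesis
    by (rule that[OF ctrl_sol_lincomb[OF lin uy(1) y0(1), of 1]]) (use uy y0 in \<open>auto simp: algebra_simps\<close>)
qed

section \<open>Realizing averaged velocities\<close>

lemma integral_join_at:
  fixes f1 f2 :: "real \<Rightarrow> 'a::euclidean_space"
  assumes c: "c \<in> {a..b}" and "f1 integrable_on {a..c}" "f2 integrable_on {c..b}"
  shows "integral {a..b} (join_at c f1 f2) = integral {a..c} f1 + integral {c..b} f2"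
proof -
  have "(join_at c f1 f2 has_integral integral {a..c} f1) {a..c}"
    by (rule has_integral_eq[OF _ integrable_integral[OF assms(2)]]) (simp add: join_at_def)
  moreover have "(join_at c f1 f2 has_integral integral {c..b} f2) {c..b}"
    by (rule has_integral_spike_finite[OF _ _ integrable_integral[OF assms(3)], of "{c}"])
       (auto simp: join_at_def)
  ultimately have "(join_at c f1 f2 has_integral (integral {a..c} f1 + integral {c..b} f2)) {a..b}"
    using c by (intro has_integral_combine[of a c b]) auto
  then show ?thesis by (rule integral_unique)
qed

lemma integral_join_at_left:
  assumes "t \<le> c"
  shows "integral {a..t} (join_at c f1 f2) = integral {a..t} f1"
  using assms by (intro integral_cong) (simp add: join_at_def)

text \<open>Here \<open>A\<close> and \<open>B\<close> already contain 1/\<epsilon>.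
  \<open>ctrb\<close> is controllability in dual form, with all powers of \<open>A\<close> allowed.
  \<open>L\<close> is positive so that it can be divided by and used as an exponential rate.\<close>

locale fast_slow =
  fixes A :: "'y::euclidean_space \<Rightarrow> 'y" and B :: "'u::euclidean_space \<Rightarrow> 'y"
    and g :: "'u \<Rightarrow> 'y \<Rightarrow> 'z::euclidean_space \<Rightarrow> 'z" and L M :: real
  assumes linA: "linear A" and linB: "linear B"
    and ctrb: "\<And>q. (\<And>i v. q \<bullet> (A ^^ i) (B v) = 0) \<Longrightarrow> q = 0"
    and g_bound: "\<And>u y z. norm (g u y z) \<le> M"
    and g_lip: "\<And>u y z y' z'. dist (g u y z) (g u y' z') \<le> L * dist (y, z) (y', z')"
    and L_pos: "L > 0"
begin

section \<open>The velocity sets \<open>V\<close> and their closed neighbourhoods\<close>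

lemma M_nonneg: "M \<ge> 0"
  using order_trans[OF norm_ge_zero g_bound] .

lemma g_lip_z: "norm (g u y z - g u y z') \<le> L * norm (z - z')"
  using g_lip[of u y z y z'] by (simp add: dist_Pair_Pair dist_norm)

lemma g_lip_y: "norm (g u y z - g u y' z) \<le> L * norm (y - y')"
  using g_lip[of u y z y' z] by (simp add: dist_Pair_Pair dist_norm)

definition V :: "'z \<Rightarrow> 'z set" where
  "V z = closure (convex hull {g u y z |u y. True})"

text \<open>The Minkowski sum of \<open>V z\<close> and a closed ball, spelled as a union of
  singletons to match the facts about compactness and convexity of sums.\<close>

definition thickV :: "'z \<Rightarrow> real \<Rightarrow> 'z set" where
  "thickV z r = (\<Union>x\<in>V z. \<Union>y\<in>cball 0 r. {x + y})"

lemma g_in_V: "g u y z \<in> V z"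
  unfolding V_def by (intro subsetD[OF closure_subset] hull_inc) auto

lemma closed_V: "closed (V z)" and convex_V: "convex (V z)"
  by (auto simp: V_def intro: convex_closure convex_convex_hull)

lemma V_subset_cball: "V z \<subseteq> cball 0 M"
  unfolding V_def
  by (intro closure_minimal hull_minimal) (auto simp: g_bound)

lemma compact_V: "compact (V z)"
  using closed_V[of z] bounded_subset[OF bounded_cball V_subset_cball[of z]]
  by (simp add: compact_eq_bounded_closed)

lemma closed_thickV: "closed (thickV z r)"
  unfolding thickV_def by (intro compact_imp_closed compact_sums' compact_V compact_cball)

lemma convex_thickV: "convex (thickV z r)"
  unfolding thickV_def by (intro convex_sums convex_V convex_cball)

lemma thickV_iff: "x \<in> thickV z r \<longleftrightarrow> (\<exists>v\<in>V z. norm (x - v) \<le> r)"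
proof
  assume "x \<in> thickV z r"
  then obtain v y where "v \<in> V z" "norm y \<le> r" "x = v + y" by (auto simp: thickV_def)
  then show "\<exists>v\<in>V z. norm (x - v) \<le> r" by (intro bexI[of _ v]) simp_all
next
  assume "\<exists>v\<in>V z. norm (x - v) \<le> r"
  then obtain v where "v \<in> V z" "norm (x - v) \<le> r" by blast
  moreover have "x = v + (x - v)" by simp
  ultimately show "x \<in> thickV z r" unfolding thickV_def mem_cball_0[symmetric] by blast
qed

text \<open>Each generator \<open>g u y z\<close> moves by at most L times the distance of the slow
  states. The neighbourhood on the right is closed and convex, so it contains the closed convex hull
  as soon as it contains the generators.\<close>

lemma V_lipschitz:
  assumes "L * norm (z - z') \<le> r"
  shows "V z \<subseteq> thickV z' r"
  unfolding V_def[of z]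
proof (intro closure_minimal hull_minimal closed_thickV convex_thickV subsetI)
  fix x assume "x \<in> {g u y z |u y. True}"
  then obtain u y where x: "x = g u y z" by blast
  have "norm (x - g u y z') \<le> r" unfolding x using g_lip_z assms by (rule order_trans)
  then show "x \<in> thickV z' r" unfolding thickV_iff using g_in_V by blast
qed

section \<open>Continuity and integrability of \<open>g\<close> along controlled motions\<close>

lemma g_continuous_on:
  assumes "continuous_on X y" "continuous_on X w"
  shows "continuous_on X (\<lambda>s. g v (y s) (w s))"
proof -
  have "continuous_on UNIV (\<lambda>p. g v (fst p) (snd p))"
    by (rule lipschitz_on_continuous_on[of L], rule lipschitz_onI) (use g_lip L_pos in auto)
  then show ?thesis
    using continuous_on_compose2[of UNIV "\<lambda>p. g v (fst p) (snd p)" X "\<lambda>s. (y s, w s)"]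
      continuous_on_Pair[OF assms] by simp
qed

lemma g_continuous_within:
  assumes "continuous_on X y" "continuous_on X w" "t \<in> X" "\<forall>\<^sub>F s in at t within X. u s = u t"
  shows "continuous (at t within X) (\<lambda>s. g (u s) (y s) (w s))"
proof (rule continuous_within_comp_locally_const[where H="\<lambda>v s. g v (y s) (w s)", OF assms(4)])
  show "continuous (at t within X) (\<lambda>s. g (u t) (y s) (w s))"
    using g_continuous_on[OF assms(1,2)] assms(3) by (simp add: continuous_on_eq_continuous_within)
qed

lemma g_integrable:
  assumes "ctrl_sol A B {a..b} u y" "continuous_on {a..b} w"
  shows "(\<lambda>t. g (u t) (y t) (w t)) integrable_on {a..b}"
proof -
  obtain S where S: "finite S" "\<And>t. t \<in> {a..b} - S \<Longrightarrow> \<forall>\<^sub>F s in at t within {a..b}. u s = u t"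
    using assms(1) unfolding ctrl_sol_def pw_const_def by blast
  have y: "continuous_on {a..b} y" using assms(1) unfolding ctrl_sol_def by blast
  have "continuous_on ({a..b} - S) (\<lambda>t. g (u t) (y t) (w t))"
    unfolding continuous_on_eq_continuous_within
  proof
    fix t assume t: "t \<in> {a..b} - S"
    show "continuous (at t within {a..b} - S) (\<lambda>t. g (u t) (y t) (w t))"
      by (rule continuous_within_subset[OF g_continuous_within[OF y assms(2) _ S(2)[OF t]]]) (use t in auto)
  qed
  then show ?thesis using g_bound by (rule integrable_continuous_off_finite[OF S(1)])
qed

lemma g_integrable_sub:
  assumes "ctrl_sol A B {a..b} u y" "continuous_on {a..b} w" "{c..d} \<subseteq> {a..b}"
  shows "(\<lambda>t. g (u t) (y t) (w t)) integrable_on {c..d}"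
  by (rule integrable_on_subinterval[OF g_integrable[OF assms(1,2)] assms(3)])

lemma g_join: "g (join_at c u1 u2 t) (join_at c y1 y2 t) (w t) =
    join_at c (\<lambda>t. g (u1 t) (y1 t) (w t)) (\<lambda>t. g (u2 t) (y2 t) (w t)) t"
  by (simp add: join_at_def)

text \<open>The slow state is frozen at \<open>\<zeta>\<close>, so only the fast dynamics matters.
  \<open>x\<close> is the prescribed integral rather than an average, which makes both target and
  error additive under concatenation. The final fast state is left free.\<close>

definition realizes :: "real \<Rightarrow> real \<Rightarrow> 'y \<Rightarrow> 'z \<Rightarrow> 'z \<Rightarrow> real \<Rightarrow> bool" where
  "realizes a b ya \<zeta> x e \<longleftrightarrow> (\<exists>u y. ctrl_sol A B {a..b} u y \<and> y a = ya \<and>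
     norm (integral {a..b} (\<lambda>t. g (u t) (y t) \<zeta>) - x) \<le> e)"

text \<open>The first piece ends in an unprescribed fast state, so the second must be realizable
  from every state.\<close>

lemma realizes_join:
  assumes c: "c \<in> {a..b}" and 1: "realizes a c ya \<zeta> x1 e1" and 2: "\<And>yc. realizes c b yc \<zeta> x2 e2"
  shows "realizes a b ya \<zeta> (x1 + x2) (e1 + e2)"
proof -
  obtain u1 y1 where uy1: "ctrl_sol A B {a..c} u1 y1" "y1 a = ya"
    "norm (integral {a..c} (\<lambda>t. g (u1 t) (y1 t) \<zeta>) - x1) \<le> e1"
    using 1 unfolding realizes_def by blast
  obtain u2 y2 where uy2: "ctrl_sol A B {c..b} u2 y2" "y2 c = y1 c"
    "norm (integral {c..b} (\<lambda>t. g (u2 t) (y2 t) \<zeta>) - x2) \<le> e2"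
    using 2[of "y1 c"] unfolding realizes_def by blast
  have "integral {a..b} (\<lambda>t. g (join_at c u1 u2 t) (join_at c y1 y2 t) \<zeta>) =
      integral {a..c} (\<lambda>t. g (u1 t) (y1 t) \<zeta>) + integral {c..b} (\<lambda>t. g (u2 t) (y2 t) \<zeta>)"
    unfolding g_join[where w="\<lambda>_. \<zeta>"]
    by (rule integral_join_at[OF c g_integrable[OF uy1(1)] g_integrable[OF uy2(1)]]) auto
  then have "norm (integral {a..b} (\<lambda>t. g (join_at c u1 u2 t) (join_at c y1 y2 t) \<zeta>) - (x1 + x2)) \<le> e1 + e2"
    using norm_triangle_mono[OF uy1(3) uy2(3)] by (simp add: algebra_simps)
  moreover have "ctrl_sol A B {a..b} (join_at c u1 u2) (join_at c y1 y2)"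
    using ctrl_sol_join[OF c uy1(1) uy2(1)] uy2(2) by simp
  moreover have "join_at c y1 y2 a = ya" using c uy1(2) by (simp add: join_at_def)
  ultimately show ?thesis unfolding realizes_def by blast
qed

text \<open>Continuity at time 0 of one solution on [0, 1] suffices: the system with a constant
  control is autonomous, so translation in time makes d independent of a.\<close>

lemma ctrl_sol_hold:
  assumes "\<delta> > 0"
  obtains d where "d > 0"
    "\<And>a b. a \<le> b \<Longrightarrow> b - a \<le> d \<Longrightarrow>
       \<exists>y. ctrl_sol A B {a..b} (\<lambda>_. v) y \<and> y a = \<eta> \<and> (\<forall>t\<in>{a..b}. norm (y t - \<eta>) \<le> \<delta>)"
proof -
  obtain y where y: "ctrl_sol A B {0..1} (\<lambda>_. v) y" "y 0 = \<eta>"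
    "\<And>t. t \<in> {0..1} \<Longrightarrow> (y has_vector_derivative A (y t) + B v) (at t within {0..1})"
    by (rule ctrl_sol_exists[OF linA linB pw_const_const, of 0 1 v \<eta>]) auto
  have "continuous_on {0..1} y" using y(1) unfolding ctrl_sol_def by blast
  then obtain d where d: "d > 0" "\<And>t. t \<in> {0..1} \<Longrightarrow> dist t 0 < d \<Longrightarrow> dist (y t) (y 0) < \<delta>"
    unfolding continuous_on_iff using assms by (metis atLeastAtMost_iff order_refl zero_le_one)
  show ?thesis
  proof (rule that[of "min 1 (d / 2)"])
    show "min 1 (d / 2) > 0" using d by simp
    fix a b :: real assume ab: "a \<le> b" "b - a \<le> min 1 (d / 2)"
    let ?y = "y \<circ> (\<lambda>t. t - a)"
    have img: "(\<lambda>t. t - a) ` {a..b} \<subseteq> {0..1}" using ab by auto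
    have der: "(?y has_vector_derivative A (?y t) + B v) (at t within {a..b})" if t: "t \<in> {a..b}" for t
    proof -
      have "((\<lambda>t. t - a) has_vector_derivative 1) (at t within {a..b})"
        by (auto intro!: derivative_eq_intros)
      moreover have "(y has_vector_derivative A (y (t - a)) + B v) (at (t - a) within (\<lambda>t. t - a) ` {a..b})"
        by (rule has_vector_derivative_within_subset[OF y(3) img]) (use t ab in auto)
      ultimately have "(?y has_vector_derivative 1 *\<^sub>R (A (y (t - a)) + B v)) (at t within {a..b})"
        by (rule vector_diff_chain_within)
      then show ?thesis by simp
    qed
    then have "continuous_on {a..b} ?y"
      unfolding continuous_on_eq_continuous_within using has_vector_derivative_continuous by blast
    then have "ctrl_sol A B {a..b} (\<lambda>_. v) ?y"
      unfolding ctrl_sol_def using der by (intro conjI pw_const_const exI[of _ "{}"]) auto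
    moreover have "\<forall>t\<in>{a..b}. norm (?y t - \<eta>) \<le> \<delta>"
    proof
      fix t assume "t \<in> {a..b}"
      then have "dist (y (t - a)) (y 0) < \<delta>" using ab d(1) by (intro d(2)) auto
      then show "norm (?y t - \<eta>) \<le> \<delta>" by (simp add: y(2) dist_norm)
    qed
    ultimately show "\<exists>y. ctrl_sol A B {a..b} (\<lambda>_. v) y \<and> y a = \<eta> \<and> (\<forall>t\<in>{a..b}. norm (y t - \<eta>) \<le> \<delta>)"
      using y(2) by (intro exI[of _ ?y]) simp
  qed
qed

text \<open>A small initial fraction of the interval is spent on steering the fast variable to \<open>\<eta>\<close>;
  holding the control at \<open>v\<close> afterwards keeps it close to \<open>\<eta>\<close>, provided the interval is short.\<close>

lemma realizes_g_short:
  assumes e: "e > 0"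
  obtains d where "d > 0"
    "\<And>a b ya. a < b \<Longrightarrow> b - a \<le> d \<Longrightarrow> realizes a b ya \<zeta> ((b - a) *\<^sub>R g v \<eta> \<zeta>) (e * (b - a))"
proof -
  \<comment> \<open>Keeping the fast variable within \<delta> of \<eta> changes \<open>g\<close> by
    at most L \<delta> = e/2.\<close>
  define \<delta> where "\<delta> = e / (2 * L)"
  have "\<delta> > 0" using e L_pos by (simp add: \<delta>_def)
  then obtain d where d: "d > 0"
    "\<And>a b. a \<le> b \<Longrightarrow> b - a \<le> d \<Longrightarrow>
       \<exists>y. ctrl_sol A B {a..b} (\<lambda>_. v) y \<and> y a = \<eta> \<and> (\<forall>t\<in>{a..b}. norm (y t - \<eta>) \<le> \<delta>)"
    using ctrl_sol_hold[of \<delta> v \<eta>] by blast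
  show ?thesis
  proof (rule that[OF d(1)])
    fix a b ya assume ab: "a < b" "b - a \<le> d"
    \<comment> \<open>While steering, \<open>g\<close> may differ from the target by 2 M, so the
      fraction \<theta> of the interval costs 2 M \<theta> (b - a), at most half of the budget. The
      cap 1/2 keeps c inside the interval.\<close>
    define \<theta> where "\<theta> = min (1/2) (e / (4 * (M + 1)))"
    have \<theta>: "\<theta> > 0" "\<theta> \<le> 1/2" "2 * M * \<theta> \<le> e / 2"
    proof -
      have "2 * M * \<theta> \<le> 2 * (M + 1) * \<theta>" using e M_nonneg by (intro mult_right_mono) (auto simp: \<theta>_def)
      also have "\<dots> \<le> 2 * (M + 1) * (e / (4 * (M + 1)))"
        using M_nonneg by (intro mult_left_mono) (auto simp: \<theta>_def)
      also have "\<dots> = e / 2" using M_nonneg by (simp add: divide_simps)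
      finally show "2 * M * \<theta> \<le> e / 2" .
      show "\<theta> \<le> 1/2" unfolding \<theta>_def by (rule min.cobounded1)
    qed (use e M_nonneg in \<open>auto simp: \<theta>_def\<close>)
    define c where "c = a + \<theta> * (b - a)"
    have c: "a < c" "c \<in> {a..b}" "c - a = \<theta> * (b - a)"
    proof -
      show "a < c" using \<theta> ab by (simp add: c_def)
      have "\<theta> * (b - a) \<le> 1 * (b - a)" using \<theta> ab by (intro mult_right_mono) auto
      then show "c \<in> {a..b}" using \<open>a < c\<close> by (simp add: c_def)
    qed (simp add: c_def)
    obtain u1 y1 where uy1: "ctrl_sol A B {a..c} u1 y1" "y1 a = ya" "y1 c = \<eta>"
      using steering_pw_const[OF linA linB ctrb c(1)] by blast
    obtain y2 where y2: "ctrl_sol A B {c..b} (\<lambda>_. v) y2" "y2 c = \<eta>" "\<And>t. t \<in> {c..b} \<Longrightarrow> norm (y2 t - \<eta>) \<le> \<delta>"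
      using d(2)[of c b] c ab by auto
    let ?G = "\<lambda>t. g v \<eta> \<zeta>"
    let ?u = "join_at c u1 (\<lambda>_. v)" and ?y = "join_at c y1 y2"
    have i1: "(\<lambda>t. g (u1 t) (y1 t) \<zeta>) integrable_on {a..c}"
      by (rule g_integrable[OF uy1(1)]) auto
    have i2: "(\<lambda>t. g v (y2 t) \<zeta>) integrable_on {c..b}"
      by (rule g_integrable[OF y2(1)]) auto
    have eq: "integral {a..b} (\<lambda>t. g (?u t) (?y t) \<zeta>) =
        integral {a..c} (\<lambda>t. g (u1 t) (y1 t) \<zeta>) + integral {c..b} (\<lambda>t. g v (y2 t) \<zeta>)"
      unfolding g_join[where w="\<lambda>_. \<zeta>"] by (rule integral_join_at[OF c(2) i1 i2])
    have "norm (integral {a..c} (\<lambda>t. g (u1 t) (y1 t) \<zeta> - g v \<eta> \<zeta>)) \<le> (M + M) * (c - a)"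
      using c by (intro norm_integral_le_const integrable_diff i1 order_trans[OF norm_triangle_ineq4] add_mono g_bound) auto
    also have "\<dots> = (2 * M * \<theta>) * (b - a)" unfolding c(3) by simp
    also have "\<dots> \<le> e / 2 * (b - a)" using \<theta> ab by (intro mult_right_mono) auto
    finally have 1: "norm (integral {a..c} (\<lambda>t. g (u1 t) (y1 t) \<zeta>) - (c - a) *\<^sub>R g v \<eta> \<zeta>) \<le> e / 2 * (b - a)"
      using integral_diff[OF i1 integrable_const_ivl, of "g v \<eta> \<zeta>"] c(1) by simp
    have "norm (integral {c..b} (\<lambda>t. g v (y2 t) \<zeta> - g v \<eta> \<zeta>)) \<le> (L * \<delta>) * (b - c)"
    proof (intro norm_integral_le_const integrable_diff i2)
      fix t assume "t \<in> {c..b}"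
      then have "L * norm (y2 t - \<eta>) \<le> L * \<delta>" using y2(3) L_pos by (intro mult_left_mono) auto
      then show "norm (g v (y2 t) \<zeta> - g v \<eta> \<zeta>) \<le> L * \<delta>" by (rule order_trans[OF g_lip_y])
    qed (use c in auto)
    also have "\<dots> \<le> e / 2 * (b - a)"
      using L_pos e c by (auto simp: \<delta>_def intro!: mult_mono)
    finally have 2: "norm (integral {c..b} (\<lambda>t. g v (y2 t) \<zeta>) - (b - c) *\<^sub>R g v \<eta> \<zeta>) \<le> e / 2 * (b - a)"
      using integral_diff[OF i2 integrable_const_ivl, of "g v \<eta> \<zeta>"] c(2) by simp
    have "integral {a..b} (\<lambda>t. g (?u t) (?y t) \<zeta>) - (b - a) *\<^sub>R g v \<eta> \<zeta> =
        (integral {a..c} (\<lambda>t. g (u1 t) (y1 t) \<zeta>) - (c - a) *\<^sub>R g v \<eta> \<zeta>) +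
        (integral {c..b} (\<lambda>t. g v (y2 t) \<zeta>) - (b - c) *\<^sub>R g v \<eta> \<zeta>)"
      unfolding eq by (simp add: algebra_simps)
    then have "norm (integral {a..b} (\<lambda>t. g (?u t) (?y t) \<zeta>) - (b - a) *\<^sub>R g v \<eta> \<zeta>) \<le> e / 2 * (b - a) + e / 2 * (b - a)"
      using norm_triangle_mono[OF 1 2] by simp
    moreover have "e / 2 * (b - a) + e / 2 * (b - a) = e * (b - a)" by simp
    moreover have "ctrl_sol A B {a..b} ?u ?y"
      using ctrl_sol_join[OF c(2) uy1(1) y2(1)] uy1(3) y2(2) by simp
    moreover have "?y a = ya" using c uy1(2) by (simp add: join_at_def)
    ultimately show "realizes a b ya \<zeta> ((b - a) *\<^sub>R g v \<eta> \<zeta>) (e * (b - a))"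
      unfolding realizes_def by (intro exI[of _ ?u] exI[of _ ?y]) simp
  qed
qed

text \<open>The admissible length d depends on e, \<zeta>, v and \<eta> but not on the position of
  the interval or the initial fast state. A long interval is therefore halved until the pieces are
  short; the error e (b - a) is additive, so nothing is lost.\<close>

lemma realizes_g:
  assumes e: "e > 0" and ab: "a < b"
  shows "realizes a b ya \<zeta> ((b - a) *\<^sub>R g v \<eta> \<zeta>) (e * (b - a))"
proof -
  obtain d where d: "d > 0"
    "\<And>a b ya. a < b \<Longrightarrow> b - a \<le> d \<Longrightarrow> realizes a b ya \<zeta> ((b - a) *\<^sub>R g v \<eta> \<zeta>) (e * (b - a))"
    using realizes_g_short[OF e, of \<zeta> v \<eta>] by blast
  have *: "realizes a b ya \<zeta> ((b - a) *\<^sub>R g v \<eta> \<zeta>) (e * (b - a))" if "a < b" "b - a \<le> 2 ^ n * d" for n a b ya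
    using that
  proof (induction n arbitrary: a b ya)
    case 0 then show ?case using d(2) by simp
  next
    case (Suc n)
    define c where "c = (a + b) / 2"
    have c: "c \<in> {a..b}" "a < c" "c < b" "c - a \<le> 2 ^ n * d" "b - c \<le> 2 ^ n * d"
      using Suc.prems by (auto simp: c_def field_simps)
    have "realizes a b ya \<zeta> ((c - a) *\<^sub>R g v \<eta> \<zeta> + (b - c) *\<^sub>R g v \<eta> \<zeta>) (e * (c - a) + e * (b - c))"
      using c by (intro realizes_join[OF c(1)] Suc.IH) auto
    then show ?case by (simp add: algebra_simps)
  qed
  obtain n where "(b - a) / d < 2 ^ n" using real_arch_pow[of 2 "(b - a) / d"] by auto
  then have "b - a \<le> 2 ^ n * d" using d(1) by (simp add: field_simps)
  then show ?thesis using * ab by blast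
qed

text \<open>The vectors that can be realized on average on every interval form a closed convex set.\<close>

lemma realizes_V:
  assumes x: "x \<in> V \<zeta>" and ab: "a < b" and e: "e > 0"
  shows "realizes a b ya \<zeta> ((b - a) *\<^sub>R x) (e * (b - a))"
proof -
  \<comment> \<open>All intervals, initial states and tolerances are included because convexity will
    need shorter intervals and closedness smaller tolerances.\<close>
  define W where "W = {x. \<forall>a b ya e. a < b \<longrightarrow> e > 0 \<longrightarrow> realizes a b ya \<zeta> ((b - a) *\<^sub>R x) (e * (b - a))}"
  have WD: "realizes a b ya \<zeta> ((b - a) *\<^sub>R x) (e * (b - a))" if "x \<in> W" "a < b" "e > 0" for a b ya e x
    using that unfolding W_def by blast
  have "convex W"
    unfolding convex_alt
  proof (intro ballI allI impI)
    fix x x' s assume xx: "x \<in> W" "x' \<in> W" and s: "(0::real) \<le> s \<and> s \<le> 1"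
    show "(1 - s) *\<^sub>R x + s *\<^sub>R x' \<in> W"
    proof (cases "s = 0 \<or> s = 1")
      case True then show ?thesis using xx by auto
    next
      case False
      then have s: "0 < s" "s < 1" using s by auto
      show ?thesis
        unfolding W_def
      proof (intro CollectI allI impI)
        fix a b :: real and ya e assume ab: "a < b" and e: "(e::real) > 0"
        \<comment> \<open>The interval is divided in the ratio (1 - s) : s, one vector being
          realized on each part. Both parts have positive length since s is neither 0 nor 1
          here.\<close>
        define c where "c = a + (1 - s) * (b - a)"
        have ca: "c - a = (1 - s) * (b - a)" and bc: "b - c = s * (b - a)"
          by (auto simp: c_def algebra_simps)
        have "0 < c - a" "0 < b - c" unfolding ca bc using s ab by simp_all
        then have c: "a < c" "c < b" by simp_all
        have "realizes a b ya \<zeta> ((c - a) *\<^sub>R x + (b - c) *\<^sub>R x') (e * (c - a) + e * (b - c))"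
          using c e xx by (intro realizes_join[of c] WD) auto
        moreover have "(c - a) *\<^sub>R x + (b - c) *\<^sub>R x' = (b - a) *\<^sub>R ((1 - s) *\<^sub>R x + s *\<^sub>R x')"
          unfolding ca bc by (simp add: scaleR_add_right mult.commute)
        moreover have "e * (c - a) + e * (b - c) = e * (b - a)" by (simp add: algebra_simps)
        ultimately show "realizes a b ya \<zeta> ((b - a) *\<^sub>R ((1 - s) *\<^sub>R x + s *\<^sub>R x')) (e * (b - a))"
          by simp
      qed
    qed
  qed
  moreover have "{g u y \<zeta> |u y. True} \<subseteq> W" unfolding W_def using realizes_g by auto
  moreover have "closed W"
    unfolding closure_subset_eq[symmetric]
  proof
    fix x assume x: "x \<in> closure W"
    show "x \<in> W" unfolding W_def
    proof (intro CollectI allI impI)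
      fix a b :: real and ya e assume ab: "a < b" and e: "(e::real) > 0"
      obtain x' where x': "x' \<in> W" "dist x' x < e / 2"
        using x e unfolding closure_approachable by (meson half_gt_zero)
      obtain u y where uy: "ctrl_sol A B {a..b} u y" "y a = ya"
        "norm (integral {a..b} (\<lambda>t. g (u t) (y t) \<zeta>) - (b - a) *\<^sub>R x') \<le> e / 2 * (b - a)"
        using WD[OF x'(1) ab, of "e / 2" ya] e unfolding realizes_def by auto
      have "norm ((b - a) *\<^sub>R x' - (b - a) *\<^sub>R x) \<le> e / 2 * (b - a)"
        using x'(2) ab by (simp add: dist_norm flip: scaleR_diff_right)
      from norm_triangle_mono[OF uy(3) this]
      have "norm (integral {a..b} (\<lambda>t. g (u t) (y t) \<zeta>) - (b - a) *\<^sub>R x) \<le> e / 2 * (b - a) + e / 2 * (b - a)"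
        by simp
      moreover have "e / 2 * (b - a) + e / 2 * (b - a) = e * (b - a)" by simp
      ultimately show "realizes a b ya \<zeta> ((b - a) *\<^sub>R x) (e * (b - a))"
        unfolding realizes_def using uy by (intro exI[of _ u] exI[of _ y]) simp
    qed
  qed
  ultimately have "V \<zeta> \<subseteq> W" unfolding V_def by (intro closure_minimal hull_minimal)
  then show ?thesis using x ab e WD by blast
qed

end

section \<open>Trajectories of the differential inclusion\<close>

context fast_slow begin

definition V_traj :: "real \<Rightarrow> (real \<Rightarrow> 'z) \<Rightarrow> bool" where
  "V_traj T z \<longleftrightarrow> abs_cont_on {0..T} z \<and>
     (AE t in lborel. t \<in> {0..T} \<longrightarrow> (\<exists>v. (z has_vector_derivative v) (at t within {0..T}) \<and> v \<in> V (z t)))"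

lemma V_traj_mean_value:
  assumes z: "V_traj T z" and ab: "0 \<le> a" "a < b" "b \<le> T"
    and C: "closed C" "convex C" "\<And>t. t \<in> {a..b} \<Longrightarrow> V (z t) \<subseteq> C"
  shows "(1 / (b - a)) *\<^sub>R (z b - z a) \<in> C"
proof (rule abs_cont_on_mean_value[OF _ ab C(1,2)])
  show "abs_cont_on {0..T} z" using z unfolding V_traj_def by blast
  show "C \<noteq> {}" using C(3)[of a] g_in_V ab by fastforce
  have "AE t in lborel. t \<in> {0..T} \<longrightarrow> (\<exists>v. (z has_vector_derivative v) (at t within {0..T}) \<and> v \<in> V (z t))"
    using z unfolding V_traj_def by blast
  then show "AE t in lborel. t \<in> {a..b} \<longrightarrow> (\<exists>v\<in>C. (z has_vector_derivative v) (at t within {0..T}))"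
  proof (rule AE_mp, intro AE_I2 impI)
    fix t assume t: "t \<in> {a..b}" and
      "t \<in> {0..T} \<longrightarrow> (\<exists>v. (z has_vector_derivative v) (at t within {0..T}) \<and> v \<in> V (z t))"
    then obtain v where "(z has_vector_derivative v) (at t within {0..T})" "v \<in> V (z t)" using ab by auto
    then show "\<exists>v\<in>C. (z has_vector_derivative v) (at t within {0..T})" using C(3)[OF t] by blast
  qed
qed

text \<open>All velocities lie in the ball of radius M, and the mean value property transfers this
  to difference quotients. The constant is common to all trajectories and hence passes to uniform
  limits.\<close>

lemma V_traj_lipschitz:
  assumes z: "V_traj T z"
  shows "M-lipschitz_on {0..T} z"
proof (rule lipschitz_onI[OF _ M_nonneg])
  have *: "dist (z a) (z b) \<le> M * dist a b" if ab: "0 \<le> a" "a < b" "b \<le> T" for a b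
  proof -
    have "(1 / (b - a)) *\<^sub>R (z b - z a) \<in> cball 0 M"
      by (rule V_traj_mean_value[OF z ab]) (auto simp: V_subset_cball)
    then have "norm (z b - z a) / (b - a) \<le> M" using ab by simp
    then show ?thesis
      using ab by (simp add: pos_divide_le_eq dist_norm norm_minus_commute[of "z a"])
  qed
  fix a b assume "a \<in> {0..T}" "b \<in> {0..T}"
  then show "dist (z a) (z b) \<le> M * dist a b"
    using *[of a b] *[of b a] by (cases a b rule: linorder_cases) (auto simp: dist_commute)
qed

lemma V_traj_slope:
  assumes z: "V_traj T z" and ab: "0 \<le> a" "a < b" "b \<le> T"
    and r: "\<And>t. t \<in> {a..b} \<Longrightarrow> L * norm (z t - \<zeta>) \<le> r"
  obtains v where "v \<in> V \<zeta>" "norm ((1 / (b - a)) *\<^sub>R (z b - z a) - v) \<le> r"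
proof -
  have "(1 / (b - a)) *\<^sub>R (z b - z a) \<in> thickV \<zeta> r"
    by (rule V_traj_mean_value[OF z ab closed_thickV convex_thickV V_lipschitz[OF r]])
  then show ?thesis using that unfolding thickV_iff by blast
qed

lemma V_traj_uniform_limit:
  assumes T: "T > 0"
    and lim: "\<And>e. e > 0 \<Longrightarrow> \<exists>w. V_traj T w \<and> (\<forall>t\<in>{0..T}. dist (z t) (w t) < e)"
  shows "V_traj T z"
proof -
  have lip: "M-lipschitz_on {0..T} z"
  proof (rule lipschitz_onI[OF _ M_nonneg])
    fix s t assume st: "s \<in> {0..T}" "t \<in> {0..T}"
    show "dist (z s) (z t) \<le> M * dist s t"
    proof (rule field_le_epsilon)
      fix e :: real assume "e > 0"
      then obtain w where w: "V_traj T w" "\<And>t. t \<in> {0..T} \<Longrightarrow> dist (z t) (w t) < e / 2"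
        using lim[of "e / 2"] by auto
      have "dist (z s) (z t) \<le> dist (z s) (w s) + dist (w s) (w t) + dist (z t) (w t)"
        using dist_triangle[of "z s" "z t" "w s"] dist_triangle[of "w s" "z t" "w t"]
        by (simp add: dist_commute)
      also have "\<dots> \<le> e / 2 + M * dist s t + e / 2"
        using w(2)[OF st(1)] w(2)[OF st(2)] lipschitz_onD[OF V_traj_lipschitz[OF w(1)] st] by linarith
      finally show "dist (z s) (z t) \<le> M * dist s t + e" by simp
    qed
  qed
  \<comment> \<open>Clamping the argument to [0, T] does not increase distances, so it extends the
    function to the whole line with the same Lipschitz constant.\<close>
  define f where "f t = z (max 0 (min T t))" for t
  have "M-lipschitz_on UNIV f"
  proof (rule lipschitz_onI[OF _ M_nonneg])
    fix s t :: real
    have "dist (f s) (f t) \<le> M * dist (max 0 (min T s)) (max 0 (min T t))"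
      unfolding f_def using T by (intro lipschitz_onD[OF lip]) auto
    also have "\<dots> \<le> M * dist s t"
      using M_nonneg T by (intro mult_left_mono) (auto simp: dist_real_def)
    finally show "dist (f s) (f t) \<le> M * dist s t" .
  qed
  then have ae: "AE t in lborel. \<exists>D. (f has_vector_derivative D) (at t)"
    by (rule lipschitz_AE_vector_derivative)
  have der: "D \<in> V (z t)" "(z has_vector_derivative D) (at t within {0..T})"
    if t: "t \<in> {0..T}" and D: "(f has_vector_derivative D) (at t)" for t D
  proof -
    show zD: "(z has_vector_derivative D) (at t within {0..T})"
      by (rule has_vector_derivative_transform[OF t _ has_vector_derivative_at_within[OF D]]) (auto simp: f_def)
    have "\<exists>v\<in>V (z t). dist v D < \<epsilon>" if \<epsilon>: "\<epsilon> > 0" for \<epsilon>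
    proof -
      \<comment> \<open>The error budget: e for the difference quotient of z, 2 e for exchanging z
        for w, L (M + 1) e for the drift away from \<open>z t\<close>. The remaining e in 4 gives a
        strict inequality.\<close>
      define Q where "Q = 4 + L * (M + 1)"
      have Q: "Q > 0" using L_pos M_nonneg by (auto simp: Q_def intro!: add_pos_nonneg)
      define e where "e = min 1 (\<epsilon> / Q)"
      have e: "e > 0" "e \<le> 1" "Q * e \<le> \<epsilon>"
        using \<epsilon> Q by (auto simp: e_def min_def field_simps)
      obtain \<delta> where \<delta>: "\<delta> > 0"
        "\<And>s. s \<in> {0..T} \<Longrightarrow> norm (s - t) < \<delta> \<Longrightarrow> norm (z s - z t - (s - t) *\<^sub>R D) \<le> e * norm (s - t)"
        using zD e(1) unfolding has_vector_derivative_def has_derivative_within_alt by blast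
      \<comment> \<open>The bound T/2 guarantees a point at distance h on one side of t inside
        [0, T]; \<delta>/2 and e control the quotient and the drift.\<close>
      define h where "h = min (T / 2) (min (\<delta> / 2) e)"
      have h: "h > 0" "h \<le> T / 2" "h < \<delta>" "h \<le> e"
        using T \<delta> e by (auto simp: h_def min_def)
      obtain s where s: "s \<in> {0..T}" "\<bar>s - t\<bar> = h"
        using t h by (cases "t \<le> T / 2") (auto intro: that[of "t + h"] that[of "t - h"])
      define a where "a = min s t"
      define b where "b = max s t"
      have ab: "0 \<le> a" "a < b" "b \<le> T" "b - a = h"
        using s t h by (auto simp: a_def b_def min_def max_def)
      have q: "norm ((1 / h) *\<^sub>R (z b - z a) - D) \<le> e"
      proof -
        have le: "norm (z b - z a - h *\<^sub>R D) \<le> e * h"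
        proof (cases "s \<le> t")
          case True
          then have "z b - z a - h *\<^sub>R D = - (z s - z t - (s - t) *\<^sub>R D)"
            using s(2) by (auto simp: a_def b_def algebra_simps)
          then show ?thesis using \<delta>(2)[OF s(1)] s(2) h by (simp only: norm_minus_cancel) simp
        next
          case False
          then have "z b - z a - h *\<^sub>R D = z s - z t - (s - t) *\<^sub>R D"
            using s(2) by (auto simp: a_def b_def)
          then show ?thesis using \<delta>(2)[OF s(1)] s(2) h by simp
        qed
        have eq: "(1 / h) *\<^sub>R (z b - z a) - D = (1 / h) *\<^sub>R (z b - z a - h *\<^sub>R D)"
          using h by (simp add: scaleR_diff_right)
        show ?thesis unfolding eq norm_scaleR using le h by (simp add: pos_divide_le_eq)
      qed
      \<comment> \<open>Forming quotients divides the uniform error by h, so w is chosen after h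
        with accuracy e h.\<close>
      have "e * h > 0" using e h by simp
      then obtain w where w: "V_traj T w" "\<And>t. t \<in> {0..T} \<Longrightarrow> dist (z t) (w t) < e * h"
        using lim by blast
      have near: "L * norm (w \<sigma> - z t) \<le> L * ((M + 1) * h)" if \<sigma>: "\<sigma> \<in> {a..b}" for \<sigma>
      proof (rule mult_left_mono)
        have \<sigma>T: "\<sigma> \<in> {0..T}" using \<sigma> ab by auto
        have "\<bar>\<sigma> - t\<bar> \<le> h" using \<sigma> ab s by (auto simp: a_def b_def min_def max_def split: if_splits)
        then have "dist (z \<sigma>) (z t) \<le> M * h"
          using lipschitz_onD[OF lip \<sigma>T t] mult_left_mono[of "dist \<sigma> t" h M] M_nonneg
          by (simp add: dist_real_def)
        moreover have "e * h \<le> 1 * h" using e(2) h(1) by (intro mult_right_mono) auto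
        then have "dist (w \<sigma>) (z \<sigma>) \<le> h"
          using w(2)[OF \<sigma>T] by (simp add: dist_commute)
        ultimately show "norm (w \<sigma> - z t) \<le> (M + 1) * h"
          using dist_triangle[of "w \<sigma>" "z t" "z \<sigma>"] by (simp add: dist_norm algebra_simps)
      qed (use L_pos in simp)
      obtain v where v: "v \<in> V (z t)" "norm ((1 / (b - a)) *\<^sub>R (w b - w a) - v) \<le> L * ((M + 1) * h)"
        using V_traj_slope[OF w(1) ab(1-3) near] by blast
      have qw: "norm ((1 / h) *\<^sub>R (z b - z a) - (1 / h) *\<^sub>R (w b - w a)) \<le> 2 * e"
      proof -
        have le: "norm ((z b - w b) - (z a - w a)) \<le> e * h + e * h"
          using w(2)[of a] w(2)[of b] ab norm_triangle_ineq4[of "z b - w b" "z a - w a"]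
          by (simp add: dist_norm)
        have eq: "(1 / h) *\<^sub>R (z b - z a) - (1 / h) *\<^sub>R (w b - w a) = (1 / h) *\<^sub>R ((z b - w b) - (z a - w a))"
          by (simp add: algebra_simps)
        show ?thesis unfolding eq norm_scaleR using le h by (simp add: pos_divide_le_eq)
      qed
      have eq: "v - D = ((1 / h) *\<^sub>R (z b - z a) - D) - ((1 / h) *\<^sub>R (z b - z a) - (1 / h) *\<^sub>R (w b - w a))
          - ((1 / (b - a)) *\<^sub>R (w b - w a) - v)"
        unfolding ab(4) by simp
      have "dist v D \<le> e + 2 * e + L * ((M + 1) * h)"
        unfolding dist_norm eq
        by (rule order_trans[OF norm_triangle_ineq4 add_mono[OF
              order_trans[OF norm_triangle_ineq4 add_mono[OF q qw]] v(2)]])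
      also have "L * ((M + 1) * h) \<le> L * ((M + 1) * e)"
        using h L_pos M_nonneg by (intro mult_left_mono) auto
      also have "e + 2 * e + L * ((M + 1) * e) < Q * e" using e by (simp add: Q_def algebra_simps)
      also have "\<dots> \<le> \<epsilon>" by (rule e(3))
      finally show ?thesis using v(1) by (intro bexI[of _ v]) auto
    qed
    then have "D \<in> closure (V (z t))" unfolding closure_approachable by blast
    then show "D \<in> V (z t)" using closed_V by simp
  qed
  from ae have "AE t in lborel. t \<in> {0..T} \<longrightarrow> (\<exists>v. (z has_vector_derivative v) (at t within {0..T}) \<and> v \<in> V (z t))"
    by (rule eventually_mono) (use der in blast)
  then show ?thesis
    unfolding V_traj_def using lipschitz_imp_abs_cont_on[OF lip] by blast
qed

section \<open>Following a trajectory of the inclusion on a uniform grid\<close>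

lemma V_traj_continuous: "V_traj T z \<Longrightarrow> continuous_on {0..T} z"
  by (rule lipschitz_on_continuous_on[OF V_traj_lipschitz])

text \<open>Three errors, all quadratic in the length of the cell: freezing the slow state at
  \<open>z a\<close> and moving the mean slope into \<open>V (z a)\<close> each cost L M (b - a)^2,
  and realizing that slope with tolerance b - a costs (b - a)^2.\<close>

lemma V_traj_cell:
  assumes z: "V_traj T z" and ab: "0 \<le> a" "a < b" "b \<le> T"
  obtains u y where "ctrl_sol A B {a..b} u y" "y a = ya"
    "norm (integral {a..b} (\<lambda>t. g (u t) (y t) (z t)) - (z b - z a)) \<le> (2 * L * M + 1) * (b - a)\<^sup>2"
proof -
  have near: "L * norm (z t - z a) \<le> L * M * (b - a)" if "t \<in> {a..b}" for t
  proof -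
    have "norm (z t - z a) \<le> M * \<bar>t - a\<bar>"
      using lipschitz_onD[OF V_traj_lipschitz[OF z], of t a] that ab by (auto simp: dist_norm)
    also have "\<dots> \<le> M * (b - a)" using that M_nonneg by (intro mult_left_mono) auto
    finally show ?thesis using L_pos by simp
  qed
  obtain v where v: "v \<in> V (z a)" "norm ((1 / (b - a)) *\<^sub>R (z b - z a) - v) \<le> L * M * (b - a)"
    using V_traj_slope[OF z ab near] by blast
  have v2: "norm ((b - a) *\<^sub>R v - (z b - z a)) \<le> L * M * (b - a) * (b - a)"
  proof -
    have "(b - a) *\<^sub>R v - (z b - z a) = - ((b - a) *\<^sub>R ((1 / (b - a)) *\<^sub>R (z b - z a) - v))"
      using ab by (simp add: scaleR_diff_right)
    then have "norm ((b - a) *\<^sub>R v - (z b - z a)) = (b - a) * norm ((1 / (b - a)) *\<^sub>R (z b - z a) - v)"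
      using ab by simp
    also have "\<dots> \<le> (b - a) * (L * M * (b - a))" using v(2) ab by (intro mult_left_mono) auto
    finally show ?thesis by (simp add: mult_ac)
  qed
  obtain u y where uy: "ctrl_sol A B {a..b} u y" "y a = ya"
    "norm (integral {a..b} (\<lambda>t. g (u t) (y t) (z a)) - (b - a) *\<^sub>R v) \<le> (b - a) * (b - a)"
    using realizes_V[OF v(1) ab(2), of "b - a" ya] ab unfolding realizes_def by auto
  have zc: "continuous_on {a..b} z"
    using V_traj_continuous[OF z] ab by (auto intro: continuous_on_subset)
  have i1: "(\<lambda>t. g (u t) (y t) (z t)) integrable_on {a..b}" by (rule g_integrable[OF uy(1) zc])
  have i2: "(\<lambda>t. g (u t) (y t) (z a)) integrable_on {a..b}" by (rule g_integrable[OF uy(1)]) auto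
  have "norm (integral {a..b} (\<lambda>t. g (u t) (y t) (z t) - g (u t) (y t) (z a))) \<le> L * M * (b - a) * (b - a)"
    using ab near by (intro norm_integral_le_const integrable_diff i1 i2 order_trans[OF g_lip_z]) auto
  then have 1: "norm (integral {a..b} (\<lambda>t. g (u t) (y t) (z t)) - integral {a..b} (\<lambda>t. g (u t) (y t) (z a)))
      \<le> L * M * (b - a) * (b - a)"
    using integral_diff[OF i1 i2] by simp
  have eq: "integral {a..b} (\<lambda>t. g (u t) (y t) (z t)) - (z b - z a) =
      (integral {a..b} (\<lambda>t. g (u t) (y t) (z t)) - integral {a..b} (\<lambda>t. g (u t) (y t) (z a))) +
      (integral {a..b} (\<lambda>t. g (u t) (y t) (z a)) - (b - a) *\<^sub>R v) + ((b - a) *\<^sub>R v - (z b - z a))"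
    by simp
  have "norm (integral {a..b} (\<lambda>t. g (u t) (y t) (z t)) - (z b - z a)) \<le>
      L * M * (b - a) * (b - a) + (b - a) * (b - a) + L * M * (b - a) * (b - a)"
    unfolding eq by (rule norm_triangle_mono[OF norm_triangle_mono[OF 1 uy(3)] v2])
  also have "\<dots> = (2 * L * M + 1) * (b - a)\<^sup>2"
    by (simp add: power2_eq_square algebra_simps)
  finally have "norm (integral {a..b} (\<lambda>t. g (u t) (y t) (z t)) - (z b - z a)) \<le> (2 * L * M + 1) * (b - a)\<^sup>2" .
  then show ?thesis by (rule that[OF uy(1,2)])
qed

text \<open>Two bounds are carried through the induction. At grid points the error grows by one cell
  error per step. Inside a cell the integral and the increment of z may each be as large as M h;
  this 2 M h does not accumulate because the next step starts from the bound at the grid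
  point.\<close>

lemma V_traj_grid:
  assumes z: "V_traj T z" and h: "h > 0" and n: "real n * h \<le> T"
  shows "\<exists>u y. ctrl_sol A B {0..real n * h} u y \<and> y 0 = y0 \<and>
    norm (integral {0..real n * h} (\<lambda>s. g (u s) (y s) (z s)) - (z (real n * h) - z 0))
      \<le> real n * ((2 * L * M + 1) * h\<^sup>2) \<and>
    (\<forall>t\<in>{0..real n * h}. norm (integral {0..t} (\<lambda>s. g (u s) (y s) (z s)) - (z t - z 0))
      \<le> real n * ((2 * L * M + 1) * h\<^sup>2) + 2 * M * h)"
  using n
proof (induction n)
  case 0
  \<comment> \<open>On the degenerate interval the point 0 is declared exceptional, which leaves no
    differential equation to check.\<close>
  have "ctrl_sol A B {0..0} (\<lambda>_. 0) (\<lambda>_. y0)"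
    unfolding ctrl_sol_def by (intro conjI pw_const_const continuous_on_const exI[of _ "{0}"]) auto
  then show ?case using M_nonneg h by (intro exI[of _ "\<lambda>_. 0"] exI[of _ "\<lambda>_. y0"]) simp
next
  case (Suc n)
  define c where "c = real n * h"
  define b where "b = real (Suc n) * h"
  define K where "K = (2 * L * M + 1) * h\<^sup>2"
  have K: "K \<ge> 0" using L_pos M_nonneg by (simp add: K_def)
  have c: "0 \<le> c" "c < b" "b \<le> T" "b - c = h" "c \<in> {0..b}"
    using h Suc.prems by (auto simp: c_def b_def algebra_simps)
  have "real n * h \<le> T" using c unfolding c_def by simp
  then obtain u1 y1 where 1: "ctrl_sol A B {0..c} u1 y1" "y1 0 = y0"
    "norm (integral {0..c} (\<lambda>s. g (u1 s) (y1 s) (z s)) - (z c - z 0)) \<le> real n * K"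
    "\<And>t. t \<in> {0..c} \<Longrightarrow> norm (integral {0..t} (\<lambda>s. g (u1 s) (y1 s) (z s)) - (z t - z 0)) \<le> real n * K + 2 * M * h"
    using Suc.IH unfolding c_def[symmetric] K_def[symmetric] by blast
  obtain u2 y2 where 2: "ctrl_sol A B {c..b} u2 y2" "y2 c = y1 c"
    "norm (integral {c..b} (\<lambda>s. g (u2 s) (y2 s) (z s)) - (z b - z c)) \<le> K"
    using V_traj_cell[OF z c(1-3), of "y1 c"] unfolding c(4) K_def[symmetric] by blast
  let ?f1 = "\<lambda>s. g (u1 s) (y1 s) (z s)" and ?f2 = "\<lambda>s. g (u2 s) (y2 s) (z s)"
  let ?u = "join_at c u1 u2" and ?y = "join_at c y1 y2"
  have zc: "continuous_on {0..c} z" "continuous_on {c..b} z"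
    using V_traj_continuous[OF z] c by (auto intro: continuous_on_subset)
  have i1: "?f1 integrable_on {0..c}" by (rule g_integrable[OF 1(1) zc(1)])
  have i2: "?f2 integrable_on {c..t}" if "t \<in> {c..b}" for t
    using that by (intro g_integrable_sub[OF 2(1) zc(2)]) auto
  have eq: "integral {0..t} (\<lambda>s. g (?u s) (?y s) (z s)) - (z t - z 0) =
      (integral {0..c} ?f1 - (z c - z 0)) + (integral {c..t} ?f2 - (z t - z c))" if t: "t \<in> {c..b}" for t
  proof -
    have "integral {0..t} (\<lambda>s. g (?u s) (?y s) (z s)) = integral {0..c} ?f1 + integral {c..t} ?f2"
      unfolding g_join by (rule integral_join_at[OF _ i1 i2[OF t]]) (use c t in auto)
    then show ?thesis by simp
  qed
  have "ctrl_sol A B {0..b} ?u ?y" using ctrl_sol_join[OF c(5) 1(1) 2(1)] 2(2) by simp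
  moreover have "?y 0 = y0" using c 1(2) by (simp add: join_at_def)
  moreover have "norm (integral {0..b} (\<lambda>s. g (?u s) (?y s) (z s)) - (z b - z 0)) \<le> real (Suc n) * K"
  proof -
    have "b \<in> {c..b}" using c by simp
    from norm_triangle_mono[OF 1(3) 2(3)]
    show ?thesis unfolding eq[OF \<open>b \<in> {c..b}\<close>] by (simp add: distrib_right)
  qed
  moreover have "norm (integral {0..t} (\<lambda>s. g (?u s) (?y s) (z s)) - (z t - z 0)) \<le> real (Suc n) * K + 2 * M * h"
    if t: "t \<in> {0..b}" for t
  proof (cases "t \<le> c")
    case True
    have "norm (integral {0..t} (\<lambda>s. g (?u s) (?y s) (z s)) - (z t - z 0)) \<le> real n * K + 2 * M * h"
      unfolding g_join integral_join_at_left[OF True] using t True by (intro 1(4)) simp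
    then show ?thesis using K by (simp add: algebra_simps)
  next
    case False
    then have t': "t \<in> {c..b}" using t by simp
    have "norm (integral {c..t} ?f2) \<le> M * (t - c)"
      using t' by (intro norm_integral_le_const i2 g_bound) auto
    also have "\<dots> \<le> M * h" using t' c M_nonneg by (intro mult_left_mono) auto
    finally have a1: "norm (integral {c..t} ?f2) \<le> M * h" .
    have "norm (z t - z c) \<le> M * \<bar>t - c\<bar>"
      using lipschitz_onD[OF V_traj_lipschitz[OF z], of t c] t' c by (auto simp: dist_norm)
    also have "\<dots> \<le> M * h" using t' c M_nonneg by (intro mult_left_mono) auto
    finally have a2: "norm (z t - z c) \<le> M * h" .
    have "norm (integral {c..t} ?f2 - (z t - z c)) \<le> 2 * M * h"
      using norm_triangle_ineq4[of "integral {c..t} ?f2" "z t - z c"] a1 a2 by simp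
    from norm_triangle_mono[OF 1(3) this]
    have "norm (integral {0..t} (\<lambda>s. g (?u s) (?y s) (z s)) - (z t - z 0)) \<le> real n * K + 2 * M * h"
      unfolding eq[OF t'] .
    then show ?thesis using K by (simp add: algebra_simps)
  qed
  ultimately show ?case unfolding b_def[symmetric] K_def[symmetric] by blast
qed

text \<open>The control is built along the given z. The slow equation is then solved under this
  control, and z satisfies the same integral equation up to the residual \<eta>, which Gronwall
  turns into a bound on the distance.\<close>

lemma V_traj_approx:
  assumes z: "V_traj T z" and T: "T > 0" and e: "e > 0"
  obtains u y w where "ctrl_sol A B {0..T} u y" "y 0 = y0" "continuous_on {0..T} w"
    "\<And>t. t \<in> {0..T} \<Longrightarrow> w t = z 0 + integral {0..t} (\<lambda>s. g (u s) (y s) (w s))"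
    "\<And>t. t \<in> {0..T} \<Longrightarrow> dist (z t) (w t) < e"
proof -
  \<comment> \<open>With h = T / n the residual is a constant divided by n; \<open>Q\<close> is that
    constant times the Gronwall factor on [0, T].\<close>
  define Q where "Q = 2 * ((2 * L * M + 1) * T\<^sup>2 + 2 * M * T) * exp (2 * L * T)"
  obtain n :: nat where n: "Q / e < real n" "n > 0"
    using reals_Archimedean2[of "max 0 (Q / e)"] by auto
  define h where "h = T / real n"
  have h: "h > 0" "real n * h = T" using n T by (auto simp: h_def)
  define \<eta> where "\<eta> = real n * ((2 * L * M + 1) * h\<^sup>2) + 2 * M * h"
  have \<eta>: "\<eta> \<ge> 0" using L_pos M_nonneg h by (simp add: \<eta>_def)
  have "2 * \<eta> * exp (2 * L * T) = Q / real n"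
    using n by (simp add: \<eta>_def h_def Q_def field_simps power2_eq_square)
  also have "\<dots> < e" using n e by (simp add: field_simps)
  finally have small: "2 * \<eta> * exp (2 * L * T) < e" .
  obtain u y where uy: "ctrl_sol A B {0..T} u y" "y 0 = y0"
    "\<And>t. t \<in> {0..T} \<Longrightarrow> norm (integral {0..t} (\<lambda>s. g (u s) (y s) (z s)) - (z t - z 0)) \<le> \<eta>"
    using V_traj_grid[OF z h(1), of n y0] unfolding h(2) \<eta>_def by blast
  obtain w where w: "continuous_on {0..T} w"
    "\<And>t. t \<in> {0..T} \<Longrightarrow> w t = z 0 + integral {0..t} (\<lambda>s. g (u s) (y s) (w s))"
    using picard_integral_equation[of L 0 T "\<lambda>t x. g (u t) (y t) x" "z 0"] L_pos g_lip_z g_integrable[OF uy(1)]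
    by blast
  have zc: "continuous_on {0..T} z" by (rule V_traj_continuous[OF z])
  have "dist (z t) (w t) < e" if t: "t \<in> {0..T}" for t
  proof -
    have "norm (w t - z t) \<le> 2 * \<eta> * exp (2 * L * (t - 0))"
    proof (rule gronwall_weighted[OF L_pos _ _ \<eta> t])
      show cont: "continuous_on {0..T} (\<lambda>t. norm (w t - z t))" by (intro continuous_intros w zc)
      fix t assume t: "t \<in> {0..T}"
      then have sub: "{0..t} \<subseteq> {0..T}" by auto
      have i1: "(\<lambda>s. g (u s) (y s) (w s)) integrable_on {0..t}" by (rule g_integrable_sub[OF uy(1) w(1) sub])
      have i2: "(\<lambda>s. g (u s) (y s) (z s)) integrable_on {0..t}" by (rule g_integrable_sub[OF uy(1) zc sub])
      have i3: "(\<lambda>s. norm (w s - z s)) integrable_on {0..t}"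
        by (rule integrable_continuous_real[OF continuous_on_subset[OF cont sub]])
      have "norm (integral {0..t} (\<lambda>s. g (u s) (y s) (w s) - g (u s) (y s) (z s)))
          \<le> integral {0..t} (\<lambda>s. L * norm (w s - z s))"
        by (intro integral_norm_bound_integral integrable_diff i1 i2 g_lip_z integrable_on_mult_right i3)
      then have 1: "norm (integral {0..t} (\<lambda>s. g (u s) (y s) (w s)) - integral {0..t} (\<lambda>s. g (u s) (y s) (z s)))
          \<le> L * integral {0..t} (\<lambda>s. norm (w s - z s))"
        using integral_diff[OF i1 i2] by simp
      have eq: "w t - z t = (integral {0..t} (\<lambda>s. g (u s) (y s) (w s)) - integral {0..t} (\<lambda>s. g (u s) (y s) (z s))) +
          (integral {0..t} (\<lambda>s. g (u s) (y s) (z s)) - (z t - z 0))"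
        using w(2)[OF t] by simp
      show "norm (w t - z t) \<le> \<eta> + L * integral {0..t} (\<lambda>s. norm (w s - z s))"
        unfolding eq add.commute[of \<eta>] by (rule norm_triangle_mono[OF 1 uy(3)[OF t]])
    qed
    also have "\<dots> \<le> 2 * \<eta> * exp (2 * L * T)" using t L_pos \<eta> by (intro mult_left_mono) auto
    also note small
    finally show ?thesis by (simp add: dist_norm norm_minus_commute)
  qed
  then show ?thesis using that[OF uy(1,2) w] by blast
qed

section \<open>From integral equations back to differential equations\<close>

lemma slow_solution_lipschitz:
  assumes "ctrl_sol A B {0..T} u y" "continuous_on {0..T} w"
    "\<And>t. t \<in> {0..T} \<Longrightarrow> w t = z0 + integral {0..t} (\<lambda>s. g (u s) (y s) (w s))"
  shows "M-lipschitz_on {0..T} w"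
proof (rule lipschitz_onI[OF _ M_nonneg])
  have *: "dist (w s) (w t) \<le> M * dist s t" if st: "0 \<le> s" "s \<le> t" "t \<le> T" for s t
  proof -
    have i: "(\<lambda>r. g (u r) (y r) (w r)) integrable_on {p..q}" if "0 \<le> p" "q \<le> T" for p q
      using that by (intro g_integrable_sub[OF assms(1,2)]) auto
    have "w t - w s = integral {s..t} (\<lambda>r. g (u r) (y r) (w r))"
      using Henstock_Kurzweil_Integration.integral_combine[OF st(1,2) i] st assms(3)[of s] assms(3)[of t] by (simp add: algebra_simps)
    then have "norm (w t - w s) \<le> M * (t - s)"
      using norm_integral_le_const[OF st(2) i g_bound] st by simp
    then show ?thesis using st by (simp add: dist_norm norm_minus_commute[of "w s"] dist_real_def)
  qed
  fix s t assume "s \<in> {0..T}" "t \<in> {0..T}"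
  then show "dist (w s) (w t) \<le> M * dist s t"
    using *[of s t] *[of t s] by (cases "s \<le> t") (auto simp: dist_commute)
qed

lemma slow_solution_derivative:
  assumes sol: "ctrl_sol A B {0..T} u y" and w: "continuous_on {0..T} w"
    "\<And>t. t \<in> {0..T} \<Longrightarrow> w t = z0 + integral {0..t} (\<lambda>s. g (u s) (y s) (w s))"
    and t: "t \<in> {0..T}" and u: "\<forall>\<^sub>F s in at t within {0..T}. u s = u t"
  shows "(w has_vector_derivative g (u t) (y t) (w t)) (at t within {0..T})"
proof -
  have "continuous_on {0..T} y" using sol unfolding ctrl_sol_def by blast
  then have "continuous (at t within {0..T}) (\<lambda>s. g (u s) (y s) (w s))"
    using w(1) t u by (rule g_continuous_within)
  then have "((\<lambda>t. integral {0..t} (\<lambda>s. g (u s) (y s) (w s))) has_vector_derivative g (u t) (y t) (w t)) (at t within {0..T})"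
    using integral_has_vector_derivative_continuous_at[OF g_integrable[OF sol w(1)], of t "{}"] t by simp
  then have "((\<lambda>t. z0 + integral {0..t} (\<lambda>s. g (u s) (y s) (w s))) has_vector_derivative g (u t) (y t) (w t)) (at t within {0..T})"
    by (auto intro!: derivative_eq_intros)
  then show ?thesis using t w(2) by (intro has_vector_derivative_transform[of t "{0..T}" w]) auto
qed

end

section \<open>The singularly perturbed system\<close>

lemma pw_const_borel_measurable:
  fixes u :: "real \<Rightarrow> 'a::euclidean_space"
  assumes "pw_const {a..b} u"
  shows "u \<in> borel_measurable (lebesgue_on {a..b})"
proof -
  obtain S where S: "finite S" "\<And>t. t \<in> {a..b} - S \<Longrightarrow> \<forall>\<^sub>F s in at t within {a..b}. u s = u t"
    using assms unfolding pw_const_def by blast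
  have "continuous_on ({a..b} - S) u"
    unfolding continuous_on_eq_continuous_within
  proof
    fix t assume "t \<in> {a..b} - S"
    then have "continuous (at t within {a..b}) u"
      by (rule continuous_within_comp_locally_const[where H="\<lambda>v s. v", OF S(2) continuous_const])
    then show "continuous (at t within {a..b} - S) u"
      by (rule continuous_within_subset) auto
  qed
  moreover have sets: "{a..b} - S \<in> sets lebesgue" "{a..b} \<in> sets lebesgue"
    using S(1) by (auto simp: finite_imp_closed intro!: sets.Diff)
  ultimately have "u \<in> borel_measurable (lebesgue_on ({a..b} - S))"
    by (intro continuous_imp_measurable_on_sets_lebesgue)
  then have "(\<lambda>t. if t \<in> {a..b} - S then u t else 0) \<in> borel_measurable lebesgue"
    by (simp only: borel_measurable_if[OF sets(1)])
  then have "(\<lambda>t. if t \<in> {a..b} then u t else 0) \<in> borel_measurable lebesgue"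
    by (rule measurable_discrete_difference[OF _ countable_finite[OF S(1)]]) auto
  then show ?thesis by (simp only: borel_measurable_if[OF sets(2)])
qed

text \<open>State and control are bounded, so the derivative is bounded off a finite set. Continuity
  lets the fundamental theorem of calculus cross the exceptional points, and a Lipschitz bound
  follows.\<close>

lemma ctrl_sol_abs_cont:
  fixes A :: "'y::euclidean_space \<Rightarrow> 'y" and B :: "'u::euclidean_space \<Rightarrow> 'y"
  assumes lin: "linear A" "linear B" and sol: "ctrl_sol A B {a..b} u y"
  shows "abs_cont_on {a..b} y"
proof -
  have y: "continuous_on {a..b} y" and u: "bounded (u ` {a..b})"
    using sol unfolding ctrl_sol_def pw_const_def by blast+
  obtain S where S: "finite S"
    "\<And>t. t \<in> {a..b} - S \<Longrightarrow> (y has_vector_derivative A (y t) + B (u t)) (at t within {a..b})"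
    using sol unfolding ctrl_sol_def by blast
  have "bounded (A ` y ` {a..b})" "bounded (B ` u ` {a..b})"
    using lin u compact_imp_bounded[OF compact_continuous_image[OF y compact_Icc]]
    unfolding linear_conv_bounded_linear by (auto intro: bounded_linear_image)
  then obtain K1 K2 where K: "\<And>t. t \<in> {a..b} \<Longrightarrow> norm (A (y t)) \<le> K1" "\<And>t. t \<in> {a..b} \<Longrightarrow> norm (B (u t)) \<le> K2"
    unfolding bounded_iff by fast
  define K where "K = max 0 (K1 + K2)"
  have *: "norm (y t - y s) \<le> K * (t - s)" if st: "a \<le> s" "s \<le> t" "t \<le> b" for s t
  proof -
    have "((\<lambda>r. A (y r) + B (u r)) has_integral (y t - y s)) {s..t}"
    proof (rule fundamental_theorem_of_calculus_interior_strong[OF S(1) st(2)])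
      show "continuous_on {s..t} y" using y st by (auto intro: continuous_on_subset)
      fix r assume r: "r \<in> {s<..<t} - S"
      then have "at r within {a..b} = at r" using st by (intro at_within_interior) auto
      then show "(y has_vector_derivative A (y r) + B (u r)) (at r)" using S(2)[of r] r st by auto
    qed
    then have int: "(\<lambda>r. A (y r) + B (u r)) integrable_on {s..t}"
      "integral {s..t} (\<lambda>r. A (y r) + B (u r)) = y t - y s"
      by (auto simp: has_integral_iff)
    show ?thesis
      unfolding int(2)[symmetric]
    proof (rule norm_integral_le_const[OF st(2) int(1)])
      fix r assume "r \<in> {s..t}"
      then have "r \<in> {a..b}" using st by auto
      from norm_triangle_mono[OF K[OF this]] show "norm (A (y r) + B (u r)) \<le> K" by (simp add: K_def)
    qed
  qed
  have "K-lipschitz_on {a..b} y"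
  proof (rule lipschitz_onI)
    fix s t assume "s \<in> {a..b}" "t \<in> {a..b}"
    then show "dist (y s) (y t) \<le> K * dist s t"
      using *[of s t] *[of t s] by (cases "s \<le> t") (auto simp: dist_norm norm_minus_commute[of "y s"])
  qed (simp add: K_def)
  then show ?thesis by (rule lipschitz_imp_abs_cont_on)
qed

text \<open>Every column of the controllability matrix is some \<open>matpow A i ** B\<close>
  applied to a basis vector, so its transpose annihilates \<open>q\<close>. Full row rank makes the
  transpose injective. Orthogonality for every i covers whatever exponents \<open>idx_enum\<close>
  assigns.\<close>

lemma kalman_rank_orthogonal:
  fixes A :: "real^'m^'m" and B :: "real^'k^'m"
  assumes rank: "rank (kalman_matrix A B) = CARD('m)"
    and q: "\<And>i v. q \<bullet> ((matpow A i ** B) *v v) = 0"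
  shows "q = 0"
proof -
  let ?K = "transpose (kalman_matrix A B)"
  have "(?K *v q) $ p = 0" for p
  proof -
    have "(?K *v q) $ p = q \<bullet> ((matpow A (idx_enum (snd p)) ** B) *v axis (fst p) 1)"
      unfolding matrix_vector_mult_basis
      by (simp add: matrix_vector_mult_def transpose_def kalman_matrix_def column_def inner_vec_def mult.commute)
    then show ?thesis using q by simp
  qed
  then have "?K *v q = ?K *v 0" by (simp add: vec_eq_iff)
  moreover have "inj ((*v) ?K)" using rank by (simp add: full_rank_injective[symmetric] rank_transpose)
  ultimately show ?thesis by (simp only: inj_eq)
qed

text \<open>Scaling both matrices by c only multiplies the i-th block by the power c^(i+1). For c =
  1/\<epsilon> this is nonzero, so controllability does not depend on \<epsilon>.\<close>

lemma funpow_scaled_matrix: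
  fixes A :: "real^'m^'m" and B :: "real^'k^'m"
  shows "((\<lambda>y. c *\<^sub>R (A *v y)) ^^ i) (c *\<^sub>R (B *v v)) = c ^ Suc i *\<^sub>R ((matpow A i ** B) *v v)"
proof (induction i)
  case 0 then show ?case by (simp add: matpow_def)
next
  case (Suc i)
  have "matpow A (Suc i) ** B = A ** (matpow A i ** B)" by (simp add: matpow_def matrix_mul_assoc)
  then show ?case
    using Suc by (simp add: matrix_vector_mult_scaleR flip: matrix_vector_mul_assoc)
qed

theorem theorem1:
  fixes A :: "real^'m^'m" and B :: "real^'k^'m"
    and g :: "real^'k \<Rightarrow> real^'m \<Rightarrow> real^'n \<Rightarrow> real^'n"
    and y0 :: "real^'m" and z0 :: "real^'n" and T :: real
  assumes "rank (kalman_matrix A B) = CARD('m)"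
    and "(\<lambda>(u, y, z). g u y z) \<in> borel_measurable borel"
    and "bounded (range (\<lambda>(u, y, z). g u y z))"
    and "\<exists>L. \<forall>u y z y' z'. dist (g u y z) (g u y' z') \<le> L * dist (y, z) (y', z')"
    and "T > 0"
  shows "\<forall>\<epsilon>>0. \<forall>z. in_uclosure T (ctrl_traj A B g y0 z0 T \<epsilon>) z \<longleftrightarrow> z \<in> incl_traj g z0 T"
proof (intro allI impI)
  fix \<epsilon> :: real and z :: "real \<Rightarrow> real^'n"
  assume \<epsilon>: "\<epsilon> > 0"
  obtain L0 where L0: "\<And>u y z y' z'. dist (g u y z) (g u y' z') \<le> L0 * dist (y, z) (y', z')"
    using assms(4) by blast
  obtain M where "\<forall>x\<in>range (\<lambda>(u, y, z). g u y z). norm x \<le> M"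
    using assms(3) unfolding bounded_iff by blast
  then have M: "norm (g u y z) \<le> M" for u y z
    using rangeI[of "\<lambda>(u, y, z). g u y z" "(u, y, z)"] by simp
  define A' where "A' y = (1 / \<epsilon>) *\<^sub>R (A *v y)" for y
  define B' where "B' v = (1 / \<epsilon>) *\<^sub>R (B *v v)" for v
  have lin: "linear A'" "linear B'"
    unfolding A'_def[abs_def] B'_def[abs_def]
    by (intro linear_compose_scale_right matrix_vector_mul_linear)+
  \<comment> \<open>The Lipschitz constant is raised to at least 1 to make it positive.\<close>
  interpret fast_slow A' B' g "max L0 1" M
  proof (rule fast_slow.intro)
    fix q :: "real^'m" assume q: "\<And>i v. q \<bullet> (A' ^^ i) (B' v) = 0"
    have "q \<bullet> ((matpow A i ** B) *v v) = 0" for i v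
      using q[of i v] \<epsilon> unfolding A'_def[abs_def] B'_def funpow_scaled_matrix by simp
    then show "q = 0" by (rule kalman_rank_orthogonal[OF assms(1)])
  next
    fix u :: "real^'k" and y y' :: "real^'m" and z z' :: "real^'n"
    have "L0 * dist (y, z) (y', z') \<le> max L0 1 * dist (y, z) (y', z')"
      by (intro mult_right_mono) auto
    then show "dist (g u y z) (g u y' z') \<le> max L0 1 * dist (y, z) (y', z')"
      using L0 by (rule order_trans[rotated])
  qed (use lin M in auto)
  have VV: "Vset g x = V x" for x by (simp add: Vset_def V_def)
  have incl: "w \<in> incl_traj g z0 T \<longleftrightarrow> V_traj T w \<and> w 0 = z0" for w
    unfolding incl_traj_def V_traj_def VV by blast
  show "in_uclosure T (ctrl_traj A B g y0 z0 T \<epsilon>) z \<longleftrightarrow> z \<in> incl_traj g z0 T"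
  proof
    assume cl: "in_uclosure T (ctrl_traj A B g y0 z0 T \<epsilon>) z"
    have traj: "V_traj T w \<and> w 0 = z0" if w_ctrl: "w \<in> ctrl_traj A B g y0 z0 T \<epsilon>" for w
    proof -
      obtain u y where w: "abs_cont_on {0..T} w" "w 0 = z0" and
        ae: "AE t in lborel. t \<in> {0..T} \<longrightarrow>
         (y has_vector_derivative (1/\<epsilon>) *\<^sub>R (A *v y t + B *v u t)) (at t within {0..T}) \<and>
         (w has_vector_derivative g (u t) (y t) (w t)) (at t within {0..T})"
        using w_ctrl unfolding ctrl_traj_def by blast
      from ae have "AE t in lborel. t \<in> {0..T} \<longrightarrow>
          (\<exists>v. (w has_vector_derivative v) (at t within {0..T}) \<and> v \<in> V (w t))"
        by (rule eventually_mono) (use g_in_V in blast)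
      then show ?thesis using w unfolding V_traj_def by blast
    qed
    have "V_traj T z"
    proof (rule V_traj_uniform_limit[OF assms(5)])
      fix e :: real assume "e > 0"
      then show "\<exists>w. V_traj T w \<and> (\<forall>t\<in>{0..T}. dist (z t) (w t) < e)"
        using cl traj unfolding in_uclosure_def by blast
    qed
    \<comment> \<open>The closure is tested at t = 0 as well, so the common initial value of the
      approximating trajectories is inherited.\<close>
    moreover have "dist (z 0) z0 \<le> 0"
    proof (rule field_le_epsilon)
      fix e :: real assume "e > 0"
      then obtain w where "w \<in> ctrl_traj A B g y0 z0 T \<epsilon>" "\<forall>t\<in>{0..T}. dist (z t) (w t) < e"
        using cl unfolding in_uclosure_def by blast
      then show "dist (z 0) z0 \<le> 0 + e" using traj[of w] assms(5) by force
    qed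
    ultimately show "z \<in> incl_traj g z0 T" unfolding incl by simp
  next
    assume "z \<in> incl_traj g z0 T"
    then have z: "V_traj T z" "z 0 = z0" unfolding incl by auto
    show "in_uclosure T (ctrl_traj A B g y0 z0 T \<epsilon>) z"
      unfolding in_uclosure_def
    proof (intro allI impI)
      fix e :: real assume "e > 0"
      obtain u y w where sol: "ctrl_sol A' B' {0..T} u y" "y 0 = y0" and
        w: "continuous_on {0..T} w" "\<And>t. t \<in> {0..T} \<Longrightarrow> w t = z 0 + integral {0..t} (\<lambda>s. g (u s) (y s) (w s))"
        and near: "\<And>t. t \<in> {0..T} \<Longrightarrow> dist (z t) (w t) < e"
        using V_traj_approx[OF z(1) assms(5) \<open>e > 0\<close>, of y0] by blast
      obtain S1 where S1: "finite S1"
        "\<And>t. t \<in> {0..T} - S1 \<Longrightarrow> (y has_vector_derivative A' (y t) + B' (u t)) (at t within {0..T})"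
        using sol(1) unfolding ctrl_sol_def by blast
      have u: "pw_const {0..T} u" using sol(1) unfolding ctrl_sol_def by blast
      then obtain S2 where S2: "finite S2" "\<And>t. t \<in> {0..T} - S2 \<Longrightarrow> \<forall>\<^sub>F s in at t within {0..T}. u s = u t"
        unfolding pw_const_def by blast
      have "S1 \<union> S2 \<in> null_sets lborel"
        using S1(1) S2(1) by (intro finite_imp_null_set_lborel) simp
      then have "AE t in lborel. t \<notin> S1 \<union> S2" by (rule AE_not_in)
      then have "AE t in lborel. t \<in> {0..T} \<longrightarrow>
         (y has_vector_derivative (1/\<epsilon>) *\<^sub>R (A *v y t + B *v u t)) (at t within {0..T}) \<and>
         (w has_vector_derivative g (u t) (y t) (w t)) (at t within {0..T})"
      proof (rule eventually_mono, intro impI conjI)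
        fix t assume t: "t \<notin> S1 \<union> S2" "t \<in> {0..T}"
        show "(y has_vector_derivative (1/\<epsilon>) *\<^sub>R (A *v y t + B *v u t)) (at t within {0..T})"
          using S1(2)[of t] t by (simp add: A'_def B'_def scaleR_add_right)
        show "(w has_vector_derivative g (u t) (y t) (w t)) (at t within {0..T})"
          by (rule slow_solution_derivative[OF sol(1) w t(2) S2(2)]) (use t in auto)
      qed
      moreover have "abs_cont_on {0..T} w"
        by (rule lipschitz_imp_abs_cont_on[OF slow_solution_lipschitz[OF sol(1) w]])
      moreover have "w 0 = z0" using w(2)[of 0] assms(5) z(2) by simp
      ultimately have "w \<in> ctrl_traj A B g y0 z0 T \<epsilon>"
        unfolding ctrl_traj_def using pw_const_borel_measurable[OF u] ctrl_sol_abs_cont[OF lin sol(1)] sol(2)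
        by blast
      then show "\<exists>w\<in>ctrl_traj A B g y0 z0 T \<epsilon>. \<forall>t\<in>{0..T}. dist (z t) (w t) < e"
        using near by blast
    qed
  qed
qed

end
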